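(* Let $m\ge 2$ and $d\ge 2$ be fixed integers, $\Delta=(d+1)(m-1)$, and for $(\alpha,p)\in[0,1]^2$ put $\beta=\frac{1-\alpha}{\Delta-1}$. Define $$\phi(r)=-d(m-1)r^2+2d(m-1)r,$$ $$A(\alpha,p)=\frac{1-\beta p(m-2)-\sqrt{[1-\beta p(m-2)]^2-4\alpha\beta p^2d(m-1)}}{2\beta p\,d(m-1)},$$ $$\gamma(\alpha,p)=1-\beta p\,[d(m-1)A(\alpha,p)+m-3],$$ $$\mathscr{Q}(\alpha,p)=-\alpha p\,[\gamma(\alpha,p)+\beta p(m-2)],$$ $$\mathscr{R}(\alpha,p)=\gamma(\alpha,p)\,[1-\beta p(d-1)(m-1)A(\alpha,p)]-\beta p^2(\alpha+\beta)(m-2),$$ $$\mathscr{S}(\alpha,p)=-\beta p\,[\gamma(\alpha,p)+\beta p(m-2)],$$ $$B(\alpha,p)=\frac{-\mathscr{R}(\alpha,p)+\sqrt{\mathscr{R}(\alpha,p)^2-4\,\mathscr{Q}(\alpha,p)\,\mathscr{S}(\alpha,p)}}{2\,\mathscr{Q}(\alpha,p)}.$$ Then, for every $(\alpha,p)\in[0,1]^2$ for which these expressions are well defined (nonzero denominators) and such that $\phi(B(\alpha,p))>1$, the frog model $\mathrm{FM}(\mathbb{D}_{m,d},\alpha,p)$ survives with positive probability.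
   Context: Graph. $\mathbb{D}_{m,d}$ is the free product of $d+1$ copies of the complete graph $\mathbb{K}_m$ on $m$ vertices, i.e. the Cayley graph of the free product $\mathbb{Z}_m*\cdots*\mathbb{Z}_m$ ($d+1$ factors) with respect to the generating set consisting of all non-identity elements of the factors; the same symbol denotes the vertex set. The identity element $\varnothing$ is the root. Every vertex has degree $\Delta=(d+1)(m-1)$ and there is a unique geodesic between any two vertices. For a vertex $u\ne\varnothing$, its parent $u^-$ is the neighbor of $u$ on the geodesic from $u$ to $\varnothing$; its children are the $d(m-1)$ neighbors at distance $\mathrm{dist}(\varnothing,u)+1$ from the root; its siblings are the $m-2$ neighbors at distance $\mathrm{dist}(\varnothing,u)$ from the root. All $\Delta$ neighbors of the root are children of the root. Walk. The $\alpha$-biased random walk on $\mathbb{D}_{m,d}$ is the Markov chain which, from $u\neq\varnothing$, moves to $u^-$ with probability $\alpha$ and to each of the other $\Delta-1$ neighbors with probability $\frac{1-\alpha}{\Delta-1}$; from the root it stays at the root with probability $\alpha$ and jumps to a uniformly chosen child with probability $1-\alpha$. Frog model $\mathrm{FM}(\mathbb{D}_{m,d},\alpha,p)$. Initially there is one active particle at the root and one sleeping particle at each other vertex. Each vertex $u$ carries an independent $\alpha$-biased random walk $(S_n^u)_{n\ge0}$ started at $u$ and an independent lifetime $\Xi_p^u$ with $\mathbb{P}(\Xi_p^u>n)=p^n$, $n\ge 0$ (geometric with parameter $1-p$; infinite if $p=1$). Once activated, the particle of $u$ follows its walk, visiting the sites $S_n^u$, $0\le n<\Xi_p^u$, and then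 disappears (equivalently, at each time step an active particle dies with probability $1-p$ and otherwise makes one step). When an active particle visits a vertex containing a sleeping particle, the latter becomes active. The process survives if at every time there is at least one active particle; otherwise it dies out. *)

theory Defs
  imports "HOL-Probability.Probability" "HOL-Algebra.Elementary_Groups"
begin

text \<open>
  The free product of a family of groups, realised on reduced words: a letter (i, a) is a
  non-identity element a of the i-th factor, and adjacent letters come from different factors.
\<close>

fun letter_mult :: "('i \<Rightarrow> ('a, 'b) monoid_scheme) \<Rightarrow> 'i \<times> 'a \<Rightarrow> ('i \<times> 'a) list \<Rightarrow> ('i \<times> 'a) list" where
  "letter_mult G x [] = [x]"
| "letter_mult G (i, a) ((j, b) # w) =
     (if i = j then
        (if a \<otimes>\<^bsub>G i\<^esub> b = \<one>\<^bsub>G i\<^esub> then w else (i, a \<otimes>\<^bsub>G i\<^esub> b) # w)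
      else (i, a) # (j, b) # w)"

definition free_product :: "'i set \<Rightarrow> ('i \<Rightarrow> ('a, 'b) monoid_scheme) \<Rightarrow> ('i \<times> 'a) list monoid" where
  "free_product I G =
     \<lparr>carrier = {w. (\<forall>(i, a) \<in> set w. i \<in> I \<and> a \<in> carrier (G i) \<and> a \<noteq> \<one>\<^bsub>G i\<^esub>) \<and>
                    distinct_adj (map fst w)},
      monoid.mult = (\<lambda>u v. foldr (letter_mult G) u v),
      one = []\<rparr>"

definition cayley_edges :: "('a, 'b) monoid_scheme \<Rightarrow> 'a set \<Rightarrow> ('a \<times> 'a) set" where
  "cayley_edges G X = {(u, v). u \<in> carrier G \<and> (\<exists>s\<in>X. v = u \<otimes>\<^bsub>G\<^esub> s)}"

type_synonym vertex = "(nat \<times> int) list"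

definition cyclic_free_product :: "nat \<Rightarrow> nat \<Rightarrow> vertex monoid" where
  "cyclic_free_product m d = free_product {..d} (\<lambda>_. integer_mod_group m)"

abbreviation verts :: "nat \<Rightarrow> nat \<Rightarrow> vertex set" where
  "verts m d \<equiv> carrier (cyclic_free_product m d)"

abbreviation rt :: "nat \<Rightarrow> nat \<Rightarrow> vertex" where
  "rt m d \<equiv> \<one>\<^bsub>cyclic_free_product m d\<^esub>"

definition edges :: "nat \<Rightarrow> nat \<Rightarrow> (vertex \<times> vertex) set" where
  "edges m d = cayley_edges (cyclic_free_product m d)
     {[(i, a)] | i a. i \<le> d \<and> a \<in> carrier (integer_mod_group m) \<and> a \<noteq> \<one>\<^bsub>integer_mod_group m\<^esub>}"

definition gdist :: "nat \<Rightarrow> nat \<Rightarrow> vertex \<Rightarrow> vertex \<Rightarrow> nat" where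
  "gdist m d u v = (LEAST n. (u, v) \<in> edges m d ^^ n)"

definition parent :: "nat \<Rightarrow> nat \<Rightarrow> vertex \<Rightarrow> vertex" where
  "parent m d u =
     (THE v. (u, v) \<in> edges m d \<and> gdist m d u v + gdist m d v (rt m d) = gdist m d u (rt m d))"

definition children :: "nat \<Rightarrow> nat \<Rightarrow> vertex \<Rightarrow> vertex set" where
  "children m d u = {v. (u, v) \<in> edges m d \<and> gdist m d (rt m d) v = gdist m d (rt m d) u + 1}"

definition deg :: "nat \<Rightarrow> nat \<Rightarrow> real" where
  "deg m d = (real d + 1) * (real m - 1)"

definition bias_out :: "nat \<Rightarrow> nat \<Rightarrow> real \<Rightarrow> real" where
  "bias_out m d \<alpha> = (1 - \<alpha>) / (deg m d - 1)"

definition step_prob :: "nat \<Rightarrow> nat \<Rightarrow> real \<Rightarrow> vertex \<Rightarrow> vertex \<Rightarrow> real" where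
  "step_prob m d \<alpha> u v =
     (if u = rt m d then
        (if v = u then \<alpha>
         else if v \<in> children m d u then (1 - \<alpha>) / real (card (children m d u))
         else 0)
      else
        (if v = parent m d u then \<alpha>
         else if (u, v) \<in> edges m d then bias_out m d \<alpha>
         else 0))"

text \<open>
  The frog dynamics for given trajectories s and lifetimes l. At time t, the particle of v is
  asleep if \<^term>\<open>None\<close>; \<^term>\<open>Some k\<close> means that it was woken k steps ago. The age keeps
  increasing after death: the particle is active precisely while its age is below its lifetime,
  and then sits at s v k.
\<close>

primrec frog_age ::
  "'v set \<Rightarrow> 'v \<Rightarrow> ('v \<Rightarrow> nat \<Rightarrow> 'v) \<Rightarrow> ('v \<Rightarrow> enat) \<Rightarrow> nat \<Rightarrow> 'v \<Rightarrow> nat option" where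
  "frog_age V r s l 0 = [r \<mapsto> 0]"
| "frog_age V r s l (Suc t) = (\<lambda>v.
     case frog_age V r s l t v of
       Some k \<Rightarrow> Some (Suc k)
     | None \<Rightarrow>
         if v \<in> V \<and> (\<exists>u k. frog_age V r s l t u = Some k \<and> enat (Suc k) < l u \<and> s u (Suc k) = v)
         then Some 0 else None)"

definition frogs_survive :: "'v set \<Rightarrow> 'v \<Rightarrow> ('v \<Rightarrow> nat \<Rightarrow> 'v) \<Rightarrow> ('v \<Rightarrow> enat) \<Rightarrow> bool" where
  "frogs_survive V r s l \<longleftrightarrow> (\<forall>t. \<exists>v k. frog_age V r s l t v = Some k \<and> enat k < l v)"

text \<open>
  The walks are Markov chains, specified by their finite-dimensional distributions. All walks
  and lifetimes are jointly independent, the left summand indexing the walks and the right one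
  the lifetimes. (Independence is stated for the generated sigma-algebras because the walks and
  the lifetimes take values in different types.)
\<close>

locale frog_model = prob_space M for M :: "'w measure" +
  fixes m d :: nat and \<alpha> p :: real
    and S :: "vertex \<Rightarrow> nat \<Rightarrow> 'w \<Rightarrow> vertex"
    and \<Xi> :: "vertex \<Rightarrow> 'w \<Rightarrow> enat"
  assumes walk_measurable:
      "\<And>u n. u \<in> verts m d \<Longrightarrow> random_variable (count_space UNIV) (S u n)"
    and walk_law:
      "\<And>u n x. u \<in> verts m d \<Longrightarrow>
         prob {\<omega> \<in> space M. \<forall>k\<le>n. S u k \<omega> = x k} =
         (if x 0 = u then \<Prod>k<n. step_prob m d \<alpha> (x k) (x (Suc k)) else 0)"
    and lifetime_measurable:
      "\<And>u. u \<in> verts m d \<Longrightarrow> random_variable (count_space UNIV) (\<Xi> u)"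
    and lifetime_law:
      "\<And>u n. u \<in> verts m d \<Longrightarrow> prob {\<omega> \<in> space M. \<Xi> u \<omega> > enat n} = p ^ n"
    and independence:
      "indep_sets
         (case_sum
           (\<lambda>u. sets (vimage_algebra (space M) (\<lambda>\<omega> n. S u n \<omega>) (Pi\<^sub>M UNIV (\<lambda>_. count_space UNIV))))
           (\<lambda>u. sets (vimage_algebra (space M) (\<Xi> u) (count_space UNIV))))
         (verts m d <+> verts m d)"
begin

definition survival :: "'w set" where
  "survival = {\<omega> \<in> space M. frogs_survive (verts m d) (rt m d) (\<lambda>u n. S u n \<omega>) (\<lambda>u. \<Xi> u \<omega>)}"

end

definition \<phi>_fun :: "nat \<Rightarrow> nat \<Rightarrow> real \<Rightarrow> real" where
  "\<phi>_fun m d r = - real d * (real m - 1) * r\<^sup>2 + 2 * real d * (real m - 1) * r"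

definition A_den :: "nat \<Rightarrow> nat \<Rightarrow> real \<Rightarrow> real \<Rightarrow> real" where
  "A_den m d \<alpha> p = 2 * bias_out m d \<alpha> * p * real d * (real m - 1)"

definition A_fun :: "nat \<Rightarrow> nat \<Rightarrow> real \<Rightarrow> real \<Rightarrow> real" where
  "A_fun m d \<alpha> p = (let \<beta> = bias_out m d \<alpha> in
     (1 - \<beta> * p * (real m - 2)
        - sqrt ((1 - \<beta> * p * (real m - 2))\<^sup>2 - 4 * \<alpha> * \<beta> * p\<^sup>2 * real d * (real m - 1)))
     / A_den m d \<alpha> p)"

definition \<gamma>_fun :: "nat \<Rightarrow> nat \<Rightarrow> real \<Rightarrow> real \<Rightarrow> real" where
  "\<gamma>_fun m d \<alpha> p =
     1 - bias_out m d \<alpha> * p * (real d * (real m - 1) * A_fun m d \<alpha> p + real m - 3)"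

definition Q_fun :: "nat \<Rightarrow> nat \<Rightarrow> real \<Rightarrow> real \<Rightarrow> real" where
  "Q_fun m d \<alpha> p = - \<alpha> * p * (\<gamma>_fun m d \<alpha> p + bias_out m d \<alpha> * p * (real m - 2))"

definition R_fun :: "nat \<Rightarrow> nat \<Rightarrow> real \<Rightarrow> real \<Rightarrow> real" where
  "R_fun m d \<alpha> p = (let \<beta> = bias_out m d \<alpha> in
     \<gamma>_fun m d \<alpha> p * (1 - \<beta> * p * (real d - 1) * (real m - 1) * A_fun m d \<alpha> p)
       - \<beta> * p\<^sup>2 * (\<alpha> + \<beta>) * (real m - 2))"

definition S_fun :: "nat \<Rightarrow> nat \<Rightarrow> real \<Rightarrow> real \<Rightarrow> real" where
  "S_fun m d \<alpha> p =
     - bias_out m d \<alpha> * p * (\<gamma>_fun m d \<alpha> p + bias_out m d \<alpha> * p * (real m - 2))"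

definition B_den :: "nat \<Rightarrow> nat \<Rightarrow> real \<Rightarrow> real \<Rightarrow> real" where
  "B_den m d \<alpha> p = 2 * Q_fun m d \<alpha> p"

definition B_fun :: "nat \<Rightarrow> nat \<Rightarrow> real \<Rightarrow> real \<Rightarrow> real" where
  "B_fun m d \<alpha> p =
     (- R_fun m d \<alpha> p + sqrt ((R_fun m d \<alpha> p)\<^sup>2 - 4 * Q_fun m d \<alpha> p * S_fun m d \<alpha> p))
     / B_den m d \<alpha> p"

end

theory Submission
  imports Defs
begin

text \<open>
  Let \<open>r\<close> be the probability that a killed walk started at \<open>u\<close> ever hits a given child of \<open>u\<close>. A one-step
  analysis gives a recursion in the level of \<open>u\<close> whose stationary form is the quadratic equation with
  smaller root \<open>B\<close>; hence the lower limit of \<open>r\<close> over the levels is at least \<open>B\<close>. Only lower bounds enter, so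
  infima over all vertices replace any use of the symmetries of the graph.

  Along a geodesic, a frog that has just arrived at a vertex and the frog woken there both try to
  reach the next vertex, so the wake-up of a descendant at distance \<open>k\<close>, using only frogs on the
  geodesic, has probability at least \<open>r(2r - r\<^sup>2)^(k - 1)\<close>. The mean number of such descendants is at least
  \<open>(d(m - 1))^k r(2r - r\<^sup>2)^(k - 1)\<close>, which is large for large \<open>k\<close> because \<open>\<phi>(r) > 1\<close>. Different individuals
  use disjoint sets of frogs, so the descendants contain a supercritical branching process with
  independent, uniformly bounded offspring numbers.
\<close>

section \<open>The Cayley graph\<close>

text \<open>The walk treats the root differently from the other vertices, so the chance of reaching
  a given child varies with the level: an excursion upwards may end at the root. This is why the
  recursion for \<open>down\<close> links level n + 1 to level n, and why \<phi>(B) > 1 becomes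
  effective only beyond some level N. The root frog has to bring the process to that level by
  itself; the event that it does so is independent of the frogs further down. B contains two
  auxiliary quantities. A bounds the chance of reaching the parent from below, and the chance of
  reaching a sibling is bounded by a linear expression in that of reaching a child, divided by
  \<gamma>. Eliminating it produces the coefficients Q, R and S. In both quadratic inequalities the
  unknown lies above the smaller root, so no argument has to decide which root it is. In place of
  generating functions, a second-order estimate handles the branching process: if the mean offspring
  number is at least 2 among at most K candidates, the probability of having n generations stays
  above \<epsilon> = 1/K^2 for all n.\<close>

definition letters :: "nat \<Rightarrow> nat \<Rightarrow> (nat \<times> int) set" where
  "letters m d = {..d} \<times> {1..<int m}"

lemma verts_eq:
  assumes "m \<ge> 2"
  shows "verts m d = {w. set w \<subseteq> letters m d \<and> distinct_adj (map fst w)}"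
  using assms
  by (auto simp: cyclic_free_product_def free_product_def letters_def carrier_integer_mod_group)

lemma rt_eq [simp]: "rt m d = []"
  by (simp add: cyclic_free_product_def free_product_def)

text \<open>\<open>foldr\<close> feeds the letters of u into w starting with the last one. Since u @
  w is reduced, no letter meets a neighbour from its own factor, so nothing merges and the product
  is plain concatenation.\<close>

lemma foldr_letter_mult_reduced:
  "distinct_adj (map fst (u @ w)) \<Longrightarrow> w \<noteq> [] \<Longrightarrow> foldr (letter_mult G) u w = u @ w"
proof (induction u)
  case (Cons x u)
  obtain i a where x: "x = (i, a)" by (cases x)
  have *: "foldr (letter_mult G) u w = u @ w"
    using Cons by (cases "u @ w") auto
  obtain y v where yv: "u @ w = y # v" using Cons.prems by (cases "u @ w") auto
  with Cons.prems x have "fst y \<noteq> i" by (auto simp: distinct_adj_Cons)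
  with * yv x show ?case by (cases y) auto
qed simp

lemma foldr_letter_mult_Nil:
  "distinct_adj (map fst u) \<Longrightarrow> foldr (letter_mult G) u [] = u"
  by (cases u rule: rev_cases) (auto simp: foldr_letter_mult_reduced)

text \<open>Right multiplication by a generator touches the last letter only. The three outcomes are
  cancellation, replacement within the same factor, and a new letter; they become the parent, the
  siblings and the children.\<close>

lemma foldr_letter_mult_snoc:
  assumes "m \<ge> 2" "distinct_adj (map fst (u @ [(j, b)]))"
  shows "foldr (letter_mult (\<lambda>_. integer_mod_group m)) (u @ [(j, b)]) [(i, a)] =
    (if i = j then if (b + a) mod int m = 0 then u else u @ [(j, (b + a) mod int m)]
     else u @ [(j, b), (i, a)])"
  using assms foldr_letter_mult_reduced[of u "[(j, (b + a) mod int m)]"]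
    foldr_letter_mult_reduced[of u "[(j, b), (i, a)]"]
  by (auto simp: foldr_letter_mult_Nil distinct_adj_append_iff mult_integer_mod_group)

definition kids :: "nat \<Rightarrow> nat \<Rightarrow> vertex \<Rightarrow> vertex set" where
  "kids m d u = (\<lambda>x. u @ [x]) ` {x \<in> letters m d. u = [] \<or> fst x \<noteq> fst (last u)}"

text \<open>These words differ from u in the element of the last letter only. For u = [] the term
  \<open>last u\<close> is unspecified, hence the recurring assumption u \<noteq> [].\<close>

definition siblings :: "nat \<Rightarrow> vertex \<Rightarrow> vertex set" where
  "siblings m u = (\<lambda>b. butlast u @ [(fst (last u), b)]) ` ({1..<int m} - {snd (last u)})"

lemma finite_letters [simp]: "finite (letters m d)"
  by (simp add: letters_def)

lemma finite_kids [simp]: "finite (kids m d u)"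
  by (simp add: kids_def)

lemma finite_siblings [simp]: "finite (siblings m u)"
  by (simp add: siblings_def)

lemma Nil_in_verts [simp]: "m \<ge> 2 \<Longrightarrow> [] \<in> verts m d"
  by (simp add: verts_eq)

lemma verts_butlast: "m \<ge> 2 \<Longrightarrow> u \<in> verts m d \<Longrightarrow> butlast u \<in> verts m d"
  by (cases u rule: rev_cases) (auto simp: verts_eq distinct_adj_append_iff)

lemma verts_take: "m \<ge> 2 \<Longrightarrow> u \<in> verts m d \<Longrightarrow> take n u \<in> verts m d"
  by (auto simp: verts_eq take_map[symmetric] dest: in_set_takeD)
     (metis append_take_drop_id distinct_adj_appendD1)

lemma kids_in_verts:
  assumes "m \<ge> 2" "u \<in> verts m d" shows "kids m d u \<subseteq> verts m d"
  using assms by (auto simp: verts_eq kids_def distinct_adj_append_iff last_map)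

lemma siblings_in_verts:
  assumes "m \<ge> 2" "u \<in> verts m d" "u \<noteq> []" shows "siblings m u \<subseteq> verts m d"
  using assms by (cases u rule: rev_cases)
    (auto simp: verts_eq siblings_def distinct_adj_append_iff letters_def)

lemma in_kids_iff:
  assumes "m \<ge> 2" "u \<in> verts m d"
  shows "v \<in> kids m d u \<longleftrightarrow> v \<in> verts m d \<and> v \<noteq> [] \<and> butlast v = u"
proof
  assume "v \<in> kids m d u" then show "v \<in> verts m d \<and> v \<noteq> [] \<and> butlast v = u"
    using kids_in_verts[OF assms] by (auto simp: kids_def)
next
  assume "v \<in> verts m d \<and> v \<noteq> [] \<and> butlast v = u"
  then show "v \<in> kids m d u"
    using assms by (cases v rule: rev_cases) (auto simp: kids_def verts_eq distinct_adj_append_iff last_map)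
qed

lemma edges_raw:
  assumes "m \<ge> 2"
  shows "(u, v) \<in> edges m d \<longleftrightarrow> u \<in> verts m d \<and>
    (\<exists>i a. (i, a) \<in> letters m d \<and> v = foldr (letter_mult (\<lambda>_. integer_mod_group m)) u [(i, a)])"
proof -
  have gens: "{[(i, a)] | i a. i \<le> d \<and> a \<in> carrier (integer_mod_group m) \<and> a \<noteq> \<one>\<^bsub>integer_mod_group m\<^esub>}
    = (\<lambda>x. [x]) ` letters m d"
    using assms by (auto simp: letters_def carrier_integer_mod_group)
  have mult: "x \<otimes>\<^bsub>cyclic_free_product m d\<^esub> y = foldr (letter_mult (\<lambda>_. integer_mod_group m)) x y" for x y
    by (simp add: cyclic_free_product_def free_product_def)
  show ?thesis
    unfolding edges_def cayley_edges_def gens mult by auto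
qed

lemma edges_Nil:
  assumes "m \<ge> 2" shows "([], v) \<in> edges m d \<longleftrightarrow> v \<in> kids m d []"
  using assms by (auto simp: edges_raw kids_def)

lemma edges_snoc:
  assumes m: "m \<ge> 2" and u: "u @ [(j, b)] \<in> verts m d"
  shows "(u @ [(j, b)], v) \<in> edges m d \<longleftrightarrow>
    v = u \<or> v \<in> siblings m (u @ [(j, b)]) \<or> v \<in> kids m d (u @ [(j, b)])"
proof -
  let ?G = "\<lambda>_::nat. integer_mod_group m"
  have red: "distinct_adj (map fst (u @ [(j, b)]))" and jb: "j \<le> d" "1 \<le> b" "b < int m"
    using u m by (auto simp: verts_eq letters_def)
  have "(u @ [(j, b)], v) \<in> edges m d \<longleftrightarrow>
    (\<exists>i a. i \<le> d \<and> 1 \<le> a \<and> a < int m \<and> v = foldr (letter_mult ?G) (u @ [(j, b)]) [(i, a)])"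
    using u by (auto simp: edges_raw[OF m] letters_def)
  also have "\<dots> \<longleftrightarrow> (\<exists>i a. i \<le> d \<and> 1 \<le> a \<and> a < int m \<and> v = 
    (if i = j then if (b + a) mod int m = 0 then u else u @ [(j, (b + a) mod int m)]
     else u @ [(j, b), (i, a)]))"
    unfolding foldr_letter_mult_snoc[OF m red] ..
  also have "\<dots> \<longleftrightarrow> v = u \<or> v \<in> siblings m (u @ [(j, b)]) \<or> v \<in> kids m d (u @ [(j, b)])"
  proof
    assume "\<exists>i a. i \<le> d \<and> 1 \<le> a \<and> a < int m \<and> v = 
    (if i = j then if (b + a) mod int m = 0 then u else u @ [(j, (b + a) mod int m)]
     else u @ [(j, b), (i, a)])"
    then obtain i a where ia: "i \<le> d" "1 \<le> a" "a < int m" and v: "v = 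
    (if i = j then if (b + a) mod int m = 0 then u else u @ [(j, (b + a) mod int m)]
     else u @ [(j, b), (i, a)])" by blast
    have "(b + a) mod int m \<noteq> b"
    proof
      assume "(b + a) mod int m = b"
      then have "(b + a) mod int m = b mod int m" using jb by simp
      then have "int m dvd a" by (metis add_diff_cancel_left' mod_eq_dvd_iff)
      then show False using ia zdvd_imp_le by fastforce
    qed
    moreover have "(b + a) mod int m < int m" "(b + a) mod int m \<ge> 0" using m by auto
    ultimately have "(b + a) mod int m \<noteq> 0 \<Longrightarrow> (b + a) mod int m \<in> {1..<int m} - {b}" by auto
    then show "v = u \<or> v \<in> siblings m (u @ [(j, b)]) \<or> v \<in> kids m d (u @ [(j, b)])"
      using ia v by (auto simp: siblings_def kids_def letters_def)
  next
    assume "v = u \<or> v \<in> siblings m (u @ [(j, b)]) \<or> v \<in> kids m d (u @ [(j, b)])"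
    then consider (p) "v = u" | (s) c where "1 \<le> c" "c < int m" "c \<noteq> b" "v = u @ [(j, c)]"
      | (k) i a where "i \<le> d" "1 \<le> a" "a < int m" "i \<noteq> j" "v = u @ [(j, b), (i, a)]"
      by (auto simp: siblings_def kids_def letters_def) blast
    then show "\<exists>i a. i \<le> d \<and> 1 \<le> a \<and> a < int m \<and> v = 
    (if i = j then if (b + a) mod int m = 0 then u else u @ [(j, (b + a) mod int m)]
     else u @ [(j, b), (i, a)])"
    proof cases
      case p then show ?thesis using jb by (intro exI[of _ j] exI[of _ "int m - b"]) auto
    next
      case s
      \<comment> \<open>The generator leading from b to c is c - b in the cyclic group, represented
        by its residue between 1 and m - 1.\<close>
      define a where "a = (if c > b then c - b else c - b + int m)"
      have "(b + a) mod int m = c" using s jb by (auto simp: a_def)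
      then show ?thesis using s jb by (intro exI[of _ j] exI[of _ a]) (auto simp: a_def)
    next
      case k then show ?thesis by (intro exI[of _ i] exI[of _ a]) auto
    qed
  qed
  finally show ?thesis .
qed

lemma edges_iff:
  assumes "m \<ge> 2" "u \<in> verts m d" "u \<noteq> []"
  shows "(u, v) \<in> edges m d \<longleftrightarrow> v = butlast u \<or> v \<in> siblings m u \<or> v \<in> kids m d u"
  using assms edges_snoc by (cases u rule: rev_cases) auto

lemma edges_verts: "(u, v) \<in> edges m d \<Longrightarrow> u \<in> verts m d"
  by (auto simp: edges_def cayley_edges_def)

lemma length_kids: "v \<in> kids m d u \<Longrightarrow> length v = Suc (length u)"
  by (auto simp: kids_def)

lemma length_siblings: "v \<in> siblings m u \<Longrightarrow> u \<noteq> [] \<Longrightarrow> length v = length u"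
  by (auto simp: siblings_def)

lemma edges_length:
  assumes "m \<ge> 2" "(u, v) \<in> edges m d"
  shows "length u \<le> Suc (length v)" "length v \<le> Suc (length u)" "u \<noteq> v"
proof -
  have u: "u \<in> verts m d" using edges_verts[OF assms(2)] .
  consider "v \<in> kids m d u" | "u \<noteq> []" "v = butlast u" | "u \<noteq> []" "v \<in> siblings m u"
    using assms u by (cases "u = []") (auto simp: edges_Nil edges_iff)
  then have "length u \<le> Suc (length v) \<and> length v \<le> Suc (length u) \<and> u \<noteq> v"
  proof cases
    case 1 then show ?thesis using length_kids[of v m d u] by auto
  next
    case 2 then show ?thesis by (cases u rule: rev_cases) auto
  next
    case 3 then show ?thesis using length_siblings[of v m u] by (auto simp: siblings_def) (metis last_snoc snd_conv)
  qed
  then show "length u \<le> Suc (length v)" "length v \<le> Suc (length u)" "u \<noteq> v" by auto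
qed

lemma relpow_edges_length:
  assumes m: "m \<ge> 2" shows "(u, v) \<in> edges m d ^^ n \<Longrightarrow> length u \<le> n + length v \<and> length v \<le> n + length u"
proof (induction n arbitrary: v)
  case (Suc n)
  then obtain y where "(u, y) \<in> edges m d ^^ n" "(y, v) \<in> edges m d" by auto
  with Suc.IH[of y] edges_length[OF m, of y v d] show ?case by auto
qed auto

lemma relpow_edges_from_root:
  assumes m: "m \<ge> 2" shows "u \<in> verts m d \<Longrightarrow> ([], u) \<in> edges m d ^^ length u"
proof (induction u rule: rev_induct)
  case (snoc x u)
  have u: "u \<in> verts m d" using verts_butlast[OF m snoc.prems] by simp
  have "u @ [x] \<in> kids m d u" using in_kids_iff[OF m u] snoc.prems by simp
  then have "(u, u @ [x]) \<in> edges m d"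
    using u m by (cases "u = []") (auto simp: edges_Nil edges_iff)
  with snoc.IH[OF u] show ?case by auto
qed simp

lemma relpow_edges_to_root:
  assumes m: "m \<ge> 2" shows "u \<in> verts m d \<Longrightarrow> (u, []) \<in> edges m d ^^ length u"
proof (induction u rule: rev_induct)
  case (snoc x u)
  have u: "u \<in> verts m d" using verts_butlast[OF m snoc.prems] by simp
  have "(u @ [x], u) \<in> edges m d"
    using snoc.prems m by (auto simp: edges_iff)
  then have "(u @ [x], []) \<in> edges m d ^^ Suc (length u)"
    using snoc.IH[OF u] by (rule relpow_Suc_I2)
  then show ?case by simp
qed simp

text \<open>An edge changes the word length by at most one, which bounds the distance from below;
  adding or deleting the letters one at a time attains the bound.\<close>

lemma gdist_root:
  assumes m: "m \<ge> 2" and "u \<in> verts m d"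
  shows "gdist m d [] u = length u" "gdist m d u [] = length u"
  unfolding gdist_def
  using relpow_edges_from_root[OF assms] relpow_edges_to_root[OF assms]
    relpow_edges_length[OF m, of "[]" u] relpow_edges_length[OF m, of u "[]"]
  by (auto intro!: Least_equality)

lemma gdist_edge:
  assumes m: "m \<ge> 2" and "(u, v) \<in> edges m d" shows "gdist m d u v = 1"
  unfolding gdist_def
proof (rule Least_equality)
  show "(u, v) \<in> edges m d ^^ 1" using assms by simp
  fix n assume "(u, v) \<in> edges m d ^^ n" then show "1 \<le> n"
    using edges_length(3)[OF assms] by (cases n) auto
qed

lemma edges_verts2:
  assumes m: "m \<ge> 2" and "(u, v) \<in> edges m d" shows "v \<in> verts m d"
  using assms edges_verts[OF assms(2)] verts_butlast[OF m, of u d] kids_in_verts[OF m, of u d] siblings_in_verts[OF m, of u d]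
  by (cases "u = []") (auto simp: edges_Nil edges_iff)

text \<open>Siblings keep the word length and children increase it, so deleting the last letter is
  the only step that comes closer to the root.\<close>

lemma parent_eq:
  assumes m: "m \<ge> 2" and u: "u \<in> verts m d" "u \<noteq> []"
  shows "parent m d u = butlast u"
  unfolding parent_def
proof (rule the_equality)
  have e: "(u, butlast u) \<in> edges m d" using edges_iff[OF m u] by simp
  show "(u, butlast u) \<in> edges m d \<and> gdist m d u (butlast u) + gdist m d (butlast u) (rt m d) = gdist m d u (rt m d)"
    using e gdist_edge[OF m e] gdist_root[OF m u(1)] gdist_root[OF m verts_butlast[OF m u(1)]] u by simp
next
  fix v assume v: "(u, v) \<in> edges m d \<and> gdist m d u v + gdist m d v (rt m d) = gdist m d u (rt m d)"
  then have "1 + length v = length u"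
    using gdist_edge[OF m, of u v d] gdist_root[OF m u(1)] gdist_root[OF m edges_verts2[OF m, of u v]]
    by auto
  then show "v = butlast u" using v edges_iff[OF m u] length_kids length_siblings[of v m u] u by auto
qed

lemma children_eq:
  assumes m: "m \<ge> 2" and u: "u \<in> verts m d"
  shows "children m d u = kids m d u"
proof -
  have "v \<in> children m d u \<longleftrightarrow> (u, v) \<in> edges m d \<and> length v = Suc (length u)" for v
    unfolding children_def using edges_verts2[OF m, of u v] gdist_root[OF m] u by auto
  moreover have "(u, v) \<in> edges m d \<and> length v = Suc (length u) \<longleftrightarrow> v \<in> kids m d u" for v
    using m u length_kids[of v m d u] length_siblings[of v m u]
    by (cases "u = []") (auto simp: edges_Nil edges_iff)
  ultimately show ?thesis by blast
qed

lemma siblings_disjnt: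
  assumes "u \<noteq> []"
  shows "butlast u \<notin> siblings m u" "butlast u \<notin> kids m d u" "siblings m u \<inter> kids m d u = {}"
    "u \<notin> siblings m u"
  using assms by (cases u rule: rev_cases; auto simp: siblings_def kids_def)+

lemma card_kids:
  assumes m: "m \<ge> 2" and u: "u \<in> verts m d" "u \<noteq> []"
  shows "card (kids m d u) = d * (m - 1)"
proof -
  have "{x \<in> letters m d. u = [] \<or> fst x \<noteq> fst (last u)} = ({..d} - {fst (last u)}) \<times> {1..<int m}"
    using u by (auto simp: letters_def)
  moreover have "last u \<in> letters m d" using u m last_in_set[of u] by (auto simp: verts_eq)
  then have "fst (last u) \<le> d" by (auto simp: letters_def)
  then have "card ({..d} - {fst (last u)}) = d" by simp
  moreover have "card {1..<int m} = m - 1" by simp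
  ultimately show ?thesis unfolding kids_def
    by (subst card_image) (simp_all add: inj_on_def card_cartesian_product)
qed

lemma card_siblings:
  assumes m: "m \<ge> 2" and u: "u \<in> verts m d" "u \<noteq> []"
  shows "card (siblings m u) = m - 2"
proof -
  have "last u \<in> letters m d" using u m last_in_set[of u] by (auto simp: verts_eq)
  then have "snd (last u) \<in> {1..<int m}" by (auto simp: letters_def)
  then have "card ({1..<int m} - {snd (last u)}) = m - 2" by simp
  then show ?thesis unfolding siblings_def
    by (subst card_image) (simp_all add: inj_on_def)
qed

lemma siblings_butlast: "u \<noteq> [] \<Longrightarrow> y \<in> siblings m u \<Longrightarrow> butlast y = butlast u \<and> y \<noteq> [] \<and> y \<noteq> u"
  by (cases u rule: rev_cases) (auto simp: siblings_def)

lemma kids_butlast: "y \<in> kids m d u \<Longrightarrow> butlast y = u \<and> y \<noteq> []"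
  by (auto simp: kids_def)

section \<open>Transition kernel of the biased walk\<close>

definition nbrs :: "nat \<Rightarrow> nat \<Rightarrow> vertex \<Rightarrow> vertex set" where
  "nbrs m d u = (if u = [] then insert [] (kids m d []) else insert (butlast u) (siblings m u \<union> kids m d u))"

lemma finite_nbrs [simp]: "finite (nbrs m d u)"
  by (simp add: nbrs_def)

lemma nbrs_in_verts: "m \<ge> 2 \<Longrightarrow> u \<in> verts m d \<Longrightarrow> nbrs m d u \<subseteq> verts m d"
  using verts_butlast kids_in_verts siblings_in_verts by (auto simp: nbrs_def) 

text \<open>This makes every one-step average a finite sum. At the root, \<open>nbrs\<close>
  contains the root itself because the walk may stay there.\<close>

lemma step_prob_outside_nbrs:
  assumes m: "m \<ge> 2" and u: "u \<in> verts m d" and v: "v \<notin> nbrs m d u"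
  shows "step_prob m d \<alpha> u v = 0"
  using assms by (auto simp: step_prob_def nbrs_def children_eq edges_iff parent_eq split: if_splits)

lemma sum_step_prob:
  assumes m: "m \<ge> 2" and u: "u \<in> verts m d" "u \<noteq> []"
  shows "(\<Sum>y\<in>nbrs m d u. step_prob m d \<alpha> u y * f y) =
    \<alpha> * f (butlast u) + bias_out m d \<alpha> * (\<Sum>y\<in>siblings m u. f y) + bias_out m d \<alpha> * (\<Sum>y\<in>kids m d u. f y)"
proof -
  have "(\<Sum>y\<in>nbrs m d u. step_prob m d \<alpha> u y * f y) =
    step_prob m d \<alpha> u (butlast u) * f (butlast u) + (\<Sum>y\<in>siblings m u \<union> kids m d u. step_prob m d \<alpha> u y * f y)"
    using u siblings_disjnt by (subst nbrs_def) auto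
  also have "(\<Sum>y\<in>siblings m u \<union> kids m d u. step_prob m d \<alpha> u y * f y) = (\<Sum>y\<in>siblings m u \<union> kids m d u. bias_out m d \<alpha> * f y)"
    using siblings_disjnt[OF u(2)] edges_iff[OF m u] u(2)
    by (intro sum.cong) (auto simp: step_prob_def parent_eq[OF m u])
  also have "\<dots> = bias_out m d \<alpha> * (\<Sum>y\<in>siblings m u. f y) + bias_out m d \<alpha> * (\<Sum>y\<in>kids m d u. f y)"
    using siblings_disjnt[OF u(2)] by (subst sum.union_disjoint) (auto simp: sum_distrib_left)
  finally show ?thesis using u by (simp add: step_prob_def parent_eq[OF m u])
qed

lemma card_kids_root: "m \<ge> 2 \<Longrightarrow> card (kids m d []) = (d + 1) * (m - 1)"
proof -
  have "card {1..<int m} = m - 1" "card {..d} = d + 1" by simp_all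
  then show ?thesis unfolding kids_def
    by (subst card_image) (simp_all add: inj_on_def letters_def card_cartesian_product del: card_atLeastLessThan_int card_atMost)
qed

lemma deg_gt_1:
  assumes "m \<ge> 2" "d \<ge> 2" shows "deg m d - 1 \<ge> 1" 
proof -
  have "(real d + 1) * (real m - 1) \<ge> 3 * 1"
    by (rule mult_mono) (use assms in auto)
  then show ?thesis by (simp add: deg_def)
qed

text \<open>\<Delta> - 1 splits into d(m - 1) children and m - 2 siblings, so this is the mass not
  spent on the parent.\<close>

lemma bias_out_eq:
  assumes "m \<ge> 2" "d \<ge> 2"
  shows "bias_out m d \<alpha> * (real d * (real m - 1)) + bias_out m d \<alpha> * (real m - 2) = 1 - \<alpha>"
  using deg_gt_1[OF assms] unfolding bias_out_def deg_def
  by (simp add: divide_simps) (simp add: algebra_simps)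

lemma sum_step_prob_1:
  assumes m: "m \<ge> 2" "d \<ge> 2" and u: "u \<in> verts m d"
  shows "(\<Sum>y\<in>nbrs m d u. step_prob m d \<alpha> u y) = 1"
proof (cases "u = []")
  case True
  have "[] \<notin> kids m d []" by (auto simp: kids_def)
  moreover have "(\<Sum>y\<in>kids m d []. step_prob m d \<alpha> [] y) = (\<Sum>y\<in>kids m d []. (1 - \<alpha>) / real (card (kids m d [])))"
    using calculation by (intro sum.cong) (auto simp: step_prob_def children_eq m)
  moreover have "card (kids m d []) \<noteq> 0" using m unfolding card_kids_root[OF m(1)] by simp
  then have "real (card (kids m d [])) \<noteq> 0" by (simp only: of_nat_eq_0_iff not_False_eq_True)
  ultimately show ?thesis using True m by (simp add: nbrs_def step_prob_def)
next
  case False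
  have "real (d * (m - 1)) = real d * (real m - 1)" "real (m - 2) = real m - 2" using m by (auto simp: of_nat_diff)
  then show ?thesis using sum_step_prob[OF m(1) u False, of \<alpha> "\<lambda>_. 1"] bias_out_eq[OF m, of \<alpha>] 
     card_kids[OF m(1) u False] card_siblings[OF m(1) u False] by (simp add: mult.commute)
qed

lemma step_prob_nonneg:
  assumes "m \<ge> 2" "d \<ge> 2" "0 \<le> \<alpha>" "\<alpha> \<le> 1" shows "step_prob m d \<alpha> u v \<ge> 0"
  using assms deg_gt_1[of m d] by (auto simp: step_prob_def bias_out_def)

lemma step_prob_child_pos:
  assumes m: "m \<ge> 2" "d \<ge> 2" and "\<alpha> < 1" and u: "u \<in> verts m d" "v \<in> kids m d u"
  shows "step_prob m d \<alpha> u v > 0"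
proof -
  have "card (kids m d u) > 0" using u by (auto simp: card_gt_0_iff)
  moreover have "v \<noteq> u" "v \<noteq> butlast u" using length_kids[OF u(2)] length_butlast[of u] by auto
  ultimately show ?thesis using assms deg_gt_1[of m d] edges_iff[OF m(1) u(1), of v]
    by (cases "u = []") (auto simp: step_prob_def bias_out_def children_eq parent_eq)
qed

section \<open>Hitting probabilities of a killed chain\<close>

text \<open>A point where the quadratic is nonpositive forces a nonnegative discriminant, so no junk
  value of \<^term>\<open>sqrt\<close> occurs here.\<close>

lemma ge_smaller_root:
  fixes a b c x :: real
  assumes "a > 0" "a * x\<^sup>2 + b * x + c \<le> 0"
  shows "(- b - sqrt (b\<^sup>2 - 4 * a * c)) / (2 * a) \<le> x"
proof -
  have "(2 * a * x + b)\<^sup>2 = 4 * a * (a * x\<^sup>2 + b * x + c) + (b\<^sup>2 - 4 * a * c)"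
    by (simp add: power2_eq_square algebra_simps)
  also have "\<dots> \<le> b\<^sup>2 - 4 * a * c"
    using assms by (simp add: mult_nonneg_nonpos)
  finally have "\<bar>2 * a * x + b\<bar> \<le> sqrt (b\<^sup>2 - 4 * a * c)"
    by (metis real_sqrt_abs real_sqrt_le_mono)
  then have "- b - sqrt (b\<^sup>2 - 4 * a * c) \<le> x * (2 * a)" by (simp add: algebra_simps abs_le_iff)
  then show ?thesis using assms by (simp add: divide_le_eq)
qed

text \<open>Two stages with n steps each give bounds of the form f n * g n \<le> F (n + n); this
  lets them pass to the limit.\<close>

lemma tendsto_double: "f \<longlonglongrightarrow> l \<Longrightarrow> (\<lambda>n::nat. f (n + n)) \<longlonglongrightarrow> l"
  by (rule filterlim_compose[of f _ sequentially])
     (auto intro!: filterlim_subseq strict_monoI)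

lemma sum_ge_card: "(\<And>y. y \<in> Y \<Longrightarrow> c \<le> f y) \<Longrightarrow> real (card Y) * c \<le> sum f Y"
  using sum_bounded_below[of Y c f] by simp

text \<open>\<open>hit p K N n x vs\<close> is the probability that the chain with kernel \<open>K\<close>, started at \<open>x\<close> and surviving
  each step with probability \<open>p\<close>, visits the vertices \<open>vs\<close> in this order within \<open>n\<close> steps.\<close>

fun hit :: "real \<Rightarrow> ('v \<Rightarrow> 'v \<Rightarrow> real) \<Rightarrow> ('v \<Rightarrow> 'v set) \<Rightarrow> nat \<Rightarrow> 'v \<Rightarrow> 'v list \<Rightarrow> real" where
  "hit p K N n x [] = 1"
| "hit p K N n x (v # vs) = (if x = v then hit p K N n x vs
     else case n of 0 \<Rightarrow> 0 | Suc k \<Rightarrow> p * (\<Sum>y\<in>N x. K x y * hit p K N k y (v # vs)))"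

declare hit.simps(2) [simp del]

lemma hit_same [simp]: "hit p K N n x (x # vs) = hit p K N n x vs"
  and hit_0 [simp]: "x \<noteq> v \<Longrightarrow> hit p K N 0 x (v # vs) = 0"
  and hit_Suc [simp]: "x \<noteq> v \<Longrightarrow> hit p K N (Suc k) x (v # vs) = p * (\<Sum>y\<in>N x. K x y * hit p K N k y (v # vs))"
  by (simp_all add: hit.simps(2))

locale killed_kernel =
  fixes p :: real and K :: "'v \<Rightarrow> 'v \<Rightarrow> real" and N :: "'v \<Rightarrow> 'v set" and V :: "'v set"
  assumes p01: "0 \<le> p" "p \<le> 1"
    and K_nonneg: "K x y \<ge> 0"
    and N_V: "x \<in> V \<Longrightarrow> N x \<subseteq> V"
    and K_sum: "x \<in> V \<Longrightarrow> (\<Sum>y\<in>N x. K x y) \<le> 1"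
begin

abbreviation hitn where "hitn \<equiv> hit p K N"

lemma hit_nonneg: "hitn n x vs \<ge> 0"
proof (induction "n + length vs" arbitrary: n x vs rule: less_induct)
  case less
  show ?case
  proof (cases vs)
    case (Cons v ws)
    consider "x = v" | "x \<noteq> v" "n = 0" | k where "x \<noteq> v" "n = Suc k" by (cases n) auto
    then show ?thesis
    proof cases
      case 1 then show ?thesis using less[of n ws x] Cons by simp
    next
      case (3 k)
      have "hitn k y vs \<ge> 0" for y using less[of k vs y] 3 Cons by simp
      then show ?thesis using 3 Cons by (simp add: p01 K_nonneg sum_nonneg)
    qed (simp add: Cons)
  qed simp
qed

lemma K_sum_le:
  assumes "x \<in> V" "\<And>y. y \<in> N x \<Longrightarrow> f y \<le> c" "0 \<le> c"
  shows "p * (\<Sum>y\<in>N x. K x y * f y) \<le> c"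
proof -
  have "(\<Sum>y\<in>N x. K x y * f y) \<le> (\<Sum>y\<in>N x. K x y * c)"
    by (intro sum_mono mult_left_mono assms K_nonneg)
  also have "\<dots> = (\<Sum>y\<in>N x. K x y) * c" by (simp add: sum_distrib_right)
  also have "\<dots> \<le> 1 * c" by (intro mult_right_mono K_sum assms)
  finally have "p * (\<Sum>y\<in>N x. K x y * f y) \<le> p * c" using p01 by (simp add: mult_left_mono)
  also have "\<dots> \<le> 1 * c" by (intro mult_right_mono p01 assms)
  finally show ?thesis by simp
qed

lemma hit_le_1: "x \<in> V \<Longrightarrow> hitn n x vs \<le> 1"
proof (induction "n + length vs" arbitrary: n x vs rule: less_induct)
  case less
  show ?case
  proof (cases vs)
    case (Cons v ws)
    show ?thesis
    proof (cases n)
      case (Suc k)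
      have "hitn n x ws \<le> 1" using less(1)[of n ws x] less(2) Cons by simp
      moreover have "p * (\<Sum>y\<in>N x. K x y * hitn k y (v # ws)) \<le> 1"
        by (rule K_sum_le) (use less(1)[of k vs] less(2) N_V Cons Suc in auto)
      ultimately show ?thesis using Cons Suc by (cases "x = v") simp_all
    qed (use less(1)[of n ws x] less(2) Cons in \<open>cases "x = v"; simp\<close>)
  qed simp
qed

lemma hit_mono_Suc: "hitn n x vs \<le> hitn (Suc n) x vs"
proof (induction "n + length vs" arbitrary: n x vs rule: less_induct)
  case less
  show ?case
  proof (cases vs)
    case (Cons v ws)
    have w: "hitn n x ws \<le> hitn (Suc n) x ws" using less[of n ws x] Cons by simp
    show ?thesis
    proof (cases n)
      case 0
      then show ?thesis using w Cons hit_nonneg[of "Suc 0" x vs] by (cases "x = v") simp_all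
    next
      case (Suc k)
      have "p * (\<Sum>y\<in>N x. K x y * hitn k y (v # ws)) \<le> p * (\<Sum>y\<in>N x. K x y * hitn (Suc k) y (v # ws))"
        by (intro mult_left_mono sum_mono p01 K_nonneg) (use less[of k vs] Cons Suc in auto)
      then show ?thesis using w Cons Suc by (cases "x = v") simp_all
    qed
  qed simp
qed

lemma hit_mono: "n \<le> n' \<Longrightarrow> hitn n x vs \<le> hitn n' x vs"
  by (rule lift_Suc_mono_le[of "\<lambda>n. hitn n x vs"]) (rule hit_mono_Suc)

text \<open>This is the strong Markov property at the time when \<open>vs\<close> is completed, as
  an inequality because the remaining time is cut to k steps. Induction along the recursion of
  \<open>hit\<close> replaces stopping times.\<close>

lemma hit_append_ge:
  "hitn n x vs * hitn k (last (x # vs)) ws \<le> hitn (n + k) x (vs @ ws)"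
proof (induction "n + length vs" arbitrary: n x vs rule: less_induct)
  case less
  show ?case
  proof (cases vs)
    case Nil then show ?thesis using hit_mono[of k "n + k" x ws] by simp
  next
    case (Cons v us)
    show ?thesis
    proof (cases "x = v")
      case True
      then show ?thesis using less[of n us x] Cons by simp
    next
      case False
      show ?thesis
      proof (cases n)
        case 0 then show ?thesis using Cons False hit_nonneg[of k x "vs @ ws"] by simp
      next
        case (Suc l)
        let ?c = "hitn k (last vs) ws"
        have "hitn n x vs * hitn k (last (x # vs)) ws = p * (\<Sum>y\<in>N x. K x y * (hitn l y vs * ?c))"
          using Cons Suc False by (simp add: sum_distrib_right mult.assoc)
        also have "\<dots> \<le> p * (\<Sum>y\<in>N x. K x y * hitn (l + k) y (vs @ ws))"
          by (intro mult_left_mono sum_mono p01 K_nonneg) (use less[of l vs] Cons Suc in auto)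
        also have "\<dots> = hitn (n + k) x (vs @ ws)" using Cons Suc False by simp
        finally show ?thesis .
      qed
    qed
  qed
qed

text \<open>\<open>hit_append_ge\<close> would bound the chance of visiting u and then v. Here v may
  be met earlier; at that moment the right-hand side has become 1.\<close>

lemma hit_trans:
  "x \<in> V \<Longrightarrow> u \<in> V \<Longrightarrow> hitn n x [u] * hitn k u [v] \<le> hitn (n + k) x [v]"
proof (induction n arbitrary: x)
  case 0 then show ?case using hit_nonneg[of k x "[v]"] by (cases "x = u") simp_all
next
  case (Suc n)
  show ?case
  proof (cases "x = v")
    case True
    then show ?thesis using hit_le_1[OF Suc.prems(1), of "Suc n" "[u]"] hit_le_1[OF Suc.prems(2), of k "[v]"]
      hit_nonneg[of "Suc n" x "[u]"] hit_nonneg[of k u "[v]"] 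
      by (simp add: mult_le_one)
  next
    case xv: False
    show ?thesis
    proof (cases "x = u")
      case True then show ?thesis using hit_mono[of k "Suc n + k" x "[v]"] by simp
    next
      case False
      have "hitn (Suc n) x [u] * hitn k u [v] = p * (\<Sum>y\<in>N x. K x y * (hitn n y [u] * hitn k u [v]))"
        using False by (simp add: sum_distrib_right mult.assoc)
      also have "\<dots> \<le> p * (\<Sum>y\<in>N x. K x y * hitn (n + k) y [v])"
        by (intro mult_left_mono sum_mono p01 K_nonneg Suc.IH) (use Suc.prems N_V in auto)
      also have "\<dots> = hitn (Suc n + k) x [v]" using xv by simp
      finally show ?thesis .
    qed
  qed
qed

text \<open>The sequence increases with n and, for x in V, is bounded by 1, so that the limit exists
  there.\<close>

definition H where "H x vs = lim (\<lambda>n. hitn n x vs)"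

lemma hit_tendsto: "x \<in> V \<Longrightarrow> (\<lambda>n. hitn n x vs) \<longlonglongrightarrow> H x vs"
  unfolding H_def convergent_LIMSEQ_iff[symmetric]
  by (rule Bseq_mono_convergent[OF BseqI'[of _ 1]])
     (use hit_le_1 hit_nonneg hit_mono in auto)

lemma H_nonneg: "x \<in> V \<Longrightarrow> H x vs \<ge> 0"
  by (rule LIMSEQ_le_const[OF hit_tendsto]) (auto simp: hit_nonneg)

lemma H_le_1: "x \<in> V \<Longrightarrow> H x vs \<le> 1"
  by (rule LIMSEQ_le_const2[OF hit_tendsto]) (auto simp: hit_le_1)

lemma H_self [simp]: "H x [x] = 1"
  by (simp add: H_def)

lemma H_append_ge:
  assumes "x \<in> V" "last (x # vs) \<in> V"
  shows "H x vs * H (last (x # vs)) ws \<le> H x (vs @ ws)"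
  by (rule LIMSEQ_le[OF tendsto_mult[OF hit_tendsto[OF assms(1)] hit_tendsto[OF assms(2)]]
        tendsto_double[OF hit_tendsto[OF assms(1)]]])
     (use hit_append_ge in blast)

lemma H_trans:
  assumes "x \<in> V" "u \<in> V"
  shows "H x [u] * H u [v] \<le> H x [v]"
  by (rule LIMSEQ_le[OF tendsto_mult[OF hit_tendsto[OF assms(1)] hit_tendsto[OF assms(2)]]
        tendsto_double[OF hit_tendsto[OF assms(1)]]])
     (use hit_trans assms in blast)

lemma H_step:
  assumes x: "x \<in> V" and "x \<noteq> v"
  shows "H x [v] = p * (\<Sum>y\<in>N x. K x y * H y [v])"
proof (rule LIMSEQ_unique)
  show "(\<lambda>n. hitn (Suc n) x [v]) \<longlonglongrightarrow> H x [v]"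
    using hit_tendsto[OF x] by (rule LIMSEQ_Suc)
  have "(\<lambda>n. p * (\<Sum>y\<in>N x. K x y * hitn n y [v])) \<longlonglongrightarrow> p * (\<Sum>y\<in>N x. K x y * H y [v])"
    by (intro tendsto_mult tendsto_const tendsto_sum hit_tendsto) (use N_V x in auto)
  then show "(\<lambda>n. hitn (Suc n) x [v]) \<longlonglongrightarrow> p * (\<Sum>y\<in>N x. K x y * H y [v])"
    using assms by simp
qed

end

section \<open>Hitting probabilities of the biased walk\<close>

locale tree_walk =
  fixes m d :: nat and \<alpha> p :: real
  assumes m2: "m \<ge> 2" and d2: "d \<ge> 2"
    and \<alpha>01: "0 \<le> \<alpha>" "\<alpha> \<le> 1" and p01: "0 \<le> p" "p \<le> 1"
    and A_den: "A_den m d \<alpha> p \<noteq> 0" and B_den: "B_den m d \<alpha> p \<noteq> 0"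
    and \<phi>_gt_1: "\<phi>_fun m d (B_fun m d \<alpha> p) > 1"
begin

sublocale killed_kernel p "step_prob m d \<alpha>" "nbrs m d" "verts m d"
  by unfold_locales
     (use p01 step_prob_nonneg[OF m2 d2 \<alpha>01] nbrs_in_verts[OF m2] sum_step_prob_1[OF m2 d2] in auto)

abbreviation "h x v \<equiv> H x [v]"
abbreviation "\<beta> \<equiv> bias_out m d \<alpha>"
abbreviation "A \<equiv> A_fun m d \<alpha> p"
abbreviation "\<gamma> \<equiv> \<gamma>_fun m d \<alpha> p"

text \<open>The nonzero denominator of A excludes \<beta> = 0 and p = 0, and \<alpha> = 1 would
  force \<beta> = 0.\<close>

lemma \<beta>_pos: "\<beta> > 0" and p_pos: "p > 0" and \<alpha>_lt_1: "\<alpha> < 1"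
proof -
  have "\<beta> \<ge> 0" using deg_gt_1[OF m2 d2] \<alpha>01 by (simp add: bias_out_def)
  moreover have "\<beta> \<noteq> 0" "p \<noteq> 0" using A_den by (auto simp: A_den_def)
  ultimately show "\<beta> > 0" "p > 0" using p01 by auto
  then show "\<alpha> < 1" using \<alpha>01 by (cases "\<alpha> = 1") (auto simp: bias_out_def)
qed

lemma \<beta>_sum: "\<alpha> + \<beta> * (real m - 2) + \<beta> * (real d * (real m - 1)) = 1"
  using bias_out_eq[OF m2 d2, of \<alpha>] by simp

lemma real_card_kids: "u \<in> verts m d \<Longrightarrow> u \<noteq> [] \<Longrightarrow> real (card (kids m d u)) = real d * (real m - 1)"
  using card_kids[OF m2] m2 by simp

lemma real_card_siblings: "u \<in> verts m d \<Longrightarrow> u \<noteq> [] \<Longrightarrow> real (card (siblings m u)) = real m - 2"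
  using card_siblings[OF m2] m2 by simp

lemma h_expand:
  assumes "u \<in> verts m d" "u \<noteq> []" "u \<noteq> v"
  shows "h u v = p * (\<alpha> * h (butlast u) v + \<beta> * (\<Sum>y\<in>siblings m u. h y v) + \<beta> * (\<Sum>y\<in>kids m d u. h y v))"
  using H_step[OF assms(1,3)] sum_step_prob[OF m2 assms(1,2)] by simp

section \<open>Probability of reaching the parent\<close>

definition "up = Inf {h y (butlast y) | y. y \<in> verts m d \<and> y \<noteq> []}"

lemma up_bounds: "y \<in> verts m d \<Longrightarrow> y \<noteq> [] \<Longrightarrow> up \<le> h y (butlast y)"
  and up_nonneg: "0 \<le> up" and up_le_1: "up \<le> 1"
  and up_greatest: "(\<And>y. y \<in> verts m d \<Longrightarrow> y \<noteq> [] \<Longrightarrow> c \<le> h y (butlast y)) \<Longrightarrow> c \<le> up"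
proof -
  let ?S = "{h y (butlast y) | y. y \<in> verts m d \<and> y \<noteq> []}"
  have bdd: "bdd_below ?S" by (rule bdd_belowI[of _ 0]) (auto simp: H_nonneg)
  have y0: "[(0, 1)] \<in> verts m d" using m2 by (simp add: verts_eq letters_def)
  then have ne: "?S \<noteq> {}" by blast
  show *: "\<And>y. y \<in> verts m d \<Longrightarrow> y \<noteq> [] \<Longrightarrow> up \<le> h y (butlast y)"
    unfolding up_def by (rule cInf_lower[OF _ bdd]) blast
  show "(\<And>y. y \<in> verts m d \<Longrightarrow> y \<noteq> [] \<Longrightarrow> c \<le> h y (butlast y)) \<Longrightarrow> c \<le> up"
    unfolding up_def by (rule cInf_greatest[OF ne]) auto
  show "0 \<le> up" unfolding up_def by (rule cInf_greatest[OF ne]) (auto simp: H_nonneg)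
  show "up \<le> 1" using *[OF y0] H_le_1[OF y0, of "[butlast [(0, 1)]]"] by (auto intro: order_trans)
qed

text \<open>One step from u: the parent is the target, a sibling has the same parent, and from a
  child two edges have to be climbed, which accounts for the square.\<close>

lemma up_ge: "p * (\<alpha> + \<beta> * ((real m - 2) * up) + \<beta> * (real d * (real m - 1) * up\<^sup>2)) \<le> up"
proof (rule up_greatest)
  fix u assume u: "u \<in> verts m d" "u \<noteq> []"
  have ub: "u \<noteq> butlast u" using u by (cases u rule: rev_cases) auto
  have "(real m - 2) * up \<le> (\<Sum>y\<in>siblings m u. h y (butlast u))"
    using sum_ge_card[of "siblings m u" up "\<lambda>y. h y (butlast u)"] real_card_siblings[OF u]
      up_bounds siblings_butlast[OF u(2)] siblings_in_verts[OF m2 u] by fastforce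
  moreover have "real d * (real m - 1) * up\<^sup>2 \<le> (\<Sum>y\<in>kids m d u. h y (butlast u))"
    unfolding real_card_kids[OF u, symmetric]
  proof (rule sum_ge_card)
    fix y assume y: "y \<in> kids m d u"
    then have yv: "y \<in> verts m d" using kids_in_verts[OF m2 u(1)] by auto
    have "up * up \<le> h y u * h u (butlast u)"
      using up_bounds[OF yv] kids_butlast[OF y] up_bounds[OF u] up_nonneg by (intro mult_mono H_nonneg yv) auto
    also have "\<dots> \<le> h y (butlast u)" by (rule H_trans[OF yv u(1)])
    finally show "up\<^sup>2 \<le> h y (butlast u)" by (simp add: power2_eq_square)
  qed
  ultimately have "p * (\<alpha> * h (butlast u) (butlast u) + \<beta> * ((real m - 2) * up) + \<beta> * (real d * (real m - 1) * up\<^sup>2))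
      \<le> p * (\<alpha> * h (butlast u) (butlast u) + \<beta> * (\<Sum>y\<in>siblings m u. h y (butlast u)) + \<beta> * (\<Sum>y\<in>kids m d u. h y (butlast u)))"
    using p01 \<beta>_pos \<alpha>01 by (intro mult_left_mono add_mono) auto
  then show "p * (\<alpha> + \<beta> * ((real m - 2) * up) + \<beta> * (real d * (real m - 1) * up\<^sup>2)) \<le> h u (butlast u)"
    using h_expand[OF u ub] by simp
qed

text \<open>By \<open>up_ge\<close>, a quadratic polynomial with positive leading coefficient is
  nonpositive at \<open>up\<close>, and A is its smaller root.\<close>

lemma A_le_up: "A \<le> up"
proof -
  let ?c = "real d * (real m - 1)"
  have c: "?c > 0" using m2 d2 by simp
  have "(\<beta> * p * ?c) * up\<^sup>2 + (- (1 - \<beta> * p * (real m - 2))) * up + \<alpha> * p \<le> 0"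
    using up_ge by (simp add: algebra_simps)
  then have "(- (- (1 - \<beta> * p * (real m - 2))) - sqrt ((- (1 - \<beta> * p * (real m - 2)))\<^sup>2 - 4 * (\<beta> * p * ?c) * (\<alpha> * p)))
      / (2 * (\<beta> * p * ?c)) \<le> up"
    using \<beta>_pos p_pos c by (intro ge_smaller_root) auto
  moreover have "4 * \<alpha> * \<beta> * p\<^sup>2 * real d * (real m - 1) = 4 * (\<beta> * p * ?c) * (\<alpha> * p)"
    by (simp add: power2_eq_square)
  moreover have "A_den m d \<alpha> p = 2 * (\<beta> * p * ?c)"
    by (simp add: A_den_def)
  ultimately show ?thesis
    unfolding A_fun_def Let_def by (simp only: power2_minus minus_minus)
qed

lemma \<beta>m: "\<beta> * (real m - 2) \<ge> 0" 
  using \<beta>_pos m2 by simp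

lemma A_nonneg: "0 \<le> A"
proof -
  have c: "\<beta> * (real d * (real m - 1)) \<ge> 0" using m2 d2 \<beta>_pos by simp
  have "p * (\<beta> * (real m - 2)) \<le> 1 * 1"
    by (rule mult_mono) (use p01 \<beta>_sum c \<alpha>01 \<beta>m in auto)
  then have q: "0 \<le> 1 - \<beta> * p * (real m - 2)" by (simp add: mult_ac)
  have "0 \<le> \<alpha> * \<beta> * p\<^sup>2 * (real d * (real m - 1))"
    using m2 d2 \<beta>_pos \<alpha>01 by simp
  then have "sqrt ((1 - \<beta> * p * (real m - 2))\<^sup>2 - 4 * \<alpha> * \<beta> * p\<^sup>2 * real d * (real m - 1)) \<le> 1 - \<beta> * p * (real m - 2)"
    using q by (intro real_le_lsqrt) (auto simp: algebra_simps)
  then show ?thesis using \<beta>_pos p_pos m2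
    by (simp add: A_fun_def A_den_def Let_def)
qed

text \<open>Since A \<le> 1, the mass identity \<open>\<beta>_sum\<close> bounds the bracket times
  \<beta> by 1 - \<beta>. The sibling bound will be divided by \<gamma>.\<close>

lemma \<gamma>_pos: "\<gamma> > 0"
proof -
  have "\<beta> * (real d * (real m - 1)) * A \<le> \<beta> * (real d * (real m - 1)) * 1"
    using m2 d2 \<beta>_pos A_le_up up_le_1 by (intro mult_left_mono) auto
  then have "\<beta> * (real d * (real m - 1) * A + real m - 3) \<le> 1 - \<alpha> - \<beta>"
    using \<beta>_sum by (simp add: algebra_simps)
  also have "\<dots> \<le> 1 - \<beta>" using \<alpha>01 by simp
  finally have "p * (\<beta> * (real d * (real m - 1) * A + real m - 3)) \<le> p * (1 - \<beta>)"
    using p01(1) by (rule mult_left_mono)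
  also have "p * (1 - \<beta>) < 1" using p_pos p01 \<beta>_pos 
    by (cases "\<beta> \<ge> 1") (auto simp: algebra_simps intro: order_le_less_trans)
  finally show ?thesis by (simp add: \<gamma>_fun_def mult_ac)
qed

section \<open>Probabilities of reaching a child or a sibling\<close>

definition "down n = Inf {h u v | u v. u \<in> verts m d \<and> length u \<ge> n \<and> v \<in> kids m d u}"

text \<open>The vertex \<open>w = v\<close> is included because for \<open>m = 2\<close> there are no siblings, and the infimum of the
  empty set of reals is unspecified.\<close>

definition "side n = Inf {h w v | u v w. u \<in> verts m d \<and> length u \<ge> n \<and> v \<in> kids m d u \<and> w \<in> insert v (siblings m v)}"

lemma ex_deep: "\<exists>u \<in> verts m d. length u \<ge> n \<and> u \<noteq> []"
proof (induction n)
  case 0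
  have "[(0, 1)] \<in> verts m d" using m2 by (simp add: verts_eq letters_def)
  then show ?case by force
next
  case (Suc n)
  then obtain u where u: "u \<in> verts m d" "length u \<ge> n" "u \<noteq> []" by blast
  then have "card (kids m d u) \<noteq> 0" using card_kids[OF m2 u(1,3)] m2 d2 by simp
  then have "kids m d u \<noteq> {}" by auto
  then obtain v where v: "v \<in> kids m d u" by blast
  then have "v \<in> verts m d" "length v = Suc (length u)" using kids_in_verts[OF m2 u(1)] length_kids by auto
  then show ?case using u by (intro bexI[of _ v]) auto
qed

lemma ex_kid: "u \<in> verts m d \<Longrightarrow> u \<noteq> [] \<Longrightarrow> kids m d u \<noteq> {}"
  using card_kids[OF m2, of u d] m2 d2 by auto

lemma down_le: "u \<in> verts m d \<Longrightarrow> length u \<ge> n \<Longrightarrow> v \<in> kids m d u \<Longrightarrow> down n \<le> h u v"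
  unfolding down_def by (rule cInf_lower[OF _ bdd_belowI[of _ 0]]) (auto simp: H_nonneg)

lemma down_ge: "(\<And>u v. u \<in> verts m d \<Longrightarrow> length u \<ge> n \<Longrightarrow> v \<in> kids m d u \<Longrightarrow> c \<le> h u v) \<Longrightarrow> c \<le> down n"
  unfolding down_def using ex_deep[of n] ex_kid by (intro cInf_greatest) (auto, blast)

lemma down_nonneg: "0 \<le> down n"
  by (rule down_ge) (rule H_nonneg)

lemma down_le_1: "down n \<le> 1"
proof -
  obtain u v where uv: "u \<in> verts m d" "length u \<ge> n" "v \<in> kids m d u" using ex_deep[of n] ex_kid by blast
  show ?thesis using down_le[OF uv] H_le_1[OF uv(1), of "[v]"] by simp
qed

lemma down_mono: "down n \<le> down (Suc n)"
  by (rule down_ge) (rule down_le, auto)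

lemma kids_siblings:
  assumes "v \<in> kids m d u" shows "siblings m v \<subseteq> kids m d u"
  using assms by (auto simp: kids_def siblings_def letters_def)

lemma side_le: "u \<in> verts m d \<Longrightarrow> length u \<ge> n \<Longrightarrow> v \<in> kids m d u \<Longrightarrow> w \<in> insert v (siblings m v) \<Longrightarrow> side n \<le> h w v"
  unfolding side_def
  by (rule cInf_lower[OF _ bdd_belowI[of _ 0]]) (use kids_siblings kids_in_verts[OF m2] in \<open>blast, fastforce intro: H_nonneg\<close>)

lemma side_ge: "(\<And>u v w. u \<in> verts m d \<Longrightarrow> length u \<ge> n \<Longrightarrow> v \<in> kids m d u \<Longrightarrow> w \<in> insert v (siblings m v) \<Longrightarrow> c \<le> h w v) \<Longrightarrow> c \<le> side n"
  unfolding side_def using ex_deep[of n] ex_kid by (intro cInf_greatest) (auto, blast)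

lemma side_nonneg: "0 \<le> side n"
  by (rule side_ge) (use kids_siblings kids_in_verts[OF m2] in \<open>blast intro: H_nonneg\<close>)

lemma side_le_1: "side n \<le> 1"
proof -
  obtain u v where uv: "u \<in> verts m d" "length u \<ge> n" "v \<in> kids m d u" using ex_deep[of n] ex_kid by blast
  show ?thesis using side_le[OF uv, of v] by simp
qed

text \<open>One step from a sibling w of v leads to the common parent, from which v is a child, to v
  itself, to one of m - 3 other siblings, or to a child of w, from which the return to w is counted
  with A.\<close>

lemma side_bound_aux:
  "p * (\<alpha> * down n + \<beta> * (1 + (real m - 3) * side n) + \<beta> * (real d * (real m - 1) * (A * side n))) \<le> side n"
proof (rule side_ge)
  fix u v w assume u: "u \<in> verts m d" "length u \<ge> n" and v: "v \<in> kids m d u" and w: "w \<in> insert v (siblings m v)"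
  let ?s = "side n"
  have vV: "v \<in> verts m d" "v \<noteq> []" using v kids_in_verts[OF m2 u(1)] kids_butlast by auto
  have wk: "w \<in> kids m d u" using w v kids_siblings by auto
  then have wV: "w \<in> verts m d" "w \<noteq> []" using kids_in_verts[OF m2 u(1)] kids_butlast by auto
  show "p * (\<alpha> * down n + \<beta> * (1 + (real m - 3) * ?s) + \<beta> * (real d * (real m - 1) * (A * ?s))) \<le> h w v"
  proof (cases "w = v")
    case True
    have "\<alpha> * down n \<le> \<alpha> * 1" by (intro mult_left_mono down_le_1 \<alpha>01)
    \<comment> \<open>Here w = v, so the left-hand side only has to stay below 1. For m = 2 the
      coefficient m - 3 is negative and \<open>side n\<close> cannot simply be replaced by 1; the
      excess 1 - ?s allowed here is taken back from the term of the children below.\<close>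
    moreover have "1 + (real m - 3) * ?s \<le> (real m - 2) + (1 - ?s)"
    proof -
      have "(real m - 2) * ?s \<le> (real m - 2) * 1" using m2 by (intro mult_left_mono side_le_1) auto
      then show ?thesis by (simp add: algebra_simps)
    qed
    then have "\<beta> * (1 + (real m - 3) * ?s) \<le> \<beta> * ((real m - 2) + (1 - ?s))" using \<beta>_pos by (intro mult_left_mono) auto
    moreover have "real d * (real m - 1) * (A * ?s) \<le> real d * (real m - 1) - (1 - ?s)"
    proof -
      have "A * ?s \<le> 1 * ?s" using A_le_up up_le_1 side_nonneg by (intro mult_right_mono) auto
      then have "real d * (real m - 1) * (A * ?s) \<le> real d * (real m - 1) * ?s" using m2 by (intro mult_left_mono) auto
      moreover have "1 * (1 - ?s) \<le> real d * (real m - 1) * (1 - ?s)"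
      proof (rule mult_right_mono)
        have "1 * 1 \<le> real d * (real m - 1)" by (rule mult_mono) (use m2 d2 in auto)
        then show "1 \<le> real d * (real m - 1)" by simp
      qed (use side_le_1 in auto)
      ultimately show ?thesis by (simp add: algebra_simps)
    qed
    then have "\<beta> * (real d * (real m - 1) * (A * ?s)) \<le> \<beta> * (real d * (real m - 1) - (1 - ?s))" using \<beta>_pos by (intro mult_left_mono) auto
    ultimately have "\<alpha> * down n + \<beta> * (1 + (real m - 3) * ?s) + \<beta> * (real d * (real m - 1) * (A * ?s)) \<le> 1"
      using \<beta>_sum by (simp add: algebra_simps)
    then have "p * (\<alpha> * down n + \<beta> * (1 + (real m - 3) * ?s) + \<beta> * (real d * (real m - 1) * (A * ?s))) \<le> p * 1"
      using p01 by (intro mult_left_mono) auto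
    also have "\<dots> \<le> h w v" using p01 True by simp
    finally show ?thesis .
  next
    case False
    have ws: "w \<in> siblings m v" using w False by auto
    have vs: "v \<in> siblings m w"
      using ws vV by (cases v rule: rev_cases) (auto simp: siblings_def verts_eq[OF m2] letters_def)
    have "(\<Sum>y\<in>siblings m w. h y v) = h v v + (\<Sum>y\<in>siblings m w - {v}. h y v)"
      using vs by (intro sum.remove) auto
    moreover have "real (card (siblings m w - {v})) * ?s \<le> (\<Sum>y\<in>siblings m w - {v}. h y v)"
    proof (rule sum_ge_card)
      fix y assume "y \<in> siblings m w - {v}"
      then have "y \<in> insert v (siblings m v)"
        using ws vV(2) by (cases v rule: rev_cases) (auto simp: siblings_def)
      then show "?s \<le> h y v" by (rule side_le[OF u v])
    qed
    moreover have "real (card (siblings m w - {v})) = real m - 3"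
    proof -
      have "Suc (card (siblings m w - {v})) = card (siblings m w)" using vs by (intro card_Suc_Diff1) auto
      then show ?thesis using real_card_siblings[OF wV] by linarith
    qed
    ultimately have sib: "1 + (real m - 3) * ?s \<le> (\<Sum>y\<in>siblings m w. h y v)" by simp
    have kid: "real d * (real m - 1) * (A * ?s) \<le> (\<Sum>y\<in>kids m d w. h y v)"
      unfolding real_card_kids[OF wV, symmetric]
    proof (rule sum_ge_card)
      fix y assume y: "y \<in> kids m d w"
      then have yv: "y \<in> verts m d" using kids_in_verts[OF m2 wV(1)] by auto
      have "A * ?s \<le> h y w * h w v"
        using up_bounds[OF yv] kids_butlast[OF y] A_le_up A_nonneg side_le[OF u v w] side_nonneg
        by (intro mult_mono H_nonneg yv) auto
      also have "\<dots> \<le> h y v" by (rule H_trans[OF yv wV(1)])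
      finally show "A * ?s \<le> h y v" .
    qed
    have par: "down n \<le> h (butlast w) v" using down_le[OF u v] kids_butlast[OF wk] by simp
    have "p * (\<alpha> * down n + \<beta> * (1 + (real m - 3) * ?s) + \<beta> * (real d * (real m - 1) * (A * ?s)))
      \<le> p * (\<alpha> * h (butlast w) v + \<beta> * (\<Sum>y\<in>siblings m w. h y v) + \<beta> * (\<Sum>y\<in>kids m d w. h y v))"
      using sib kid par p01 \<beta>_pos \<alpha>01 by (intro mult_left_mono add_mono) auto
    then show ?thesis using h_expand[OF wV False] by simp
  qed
qed

text \<open>All multiples of \<open>side n\<close> are collected on the right, and their total
  coefficient is \<gamma>.\<close>

lemma side_bound: "p * (\<alpha> * down n + \<beta>) \<le> side n * \<gamma>"
  using side_bound_aux[of n] by (simp add: \<gamma>_fun_def algebra_simps)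

text \<open>One step from u at level n + 1 or deeper. The parent is only known to lie at level n or
  deeper, so the way back to u is counted with \<open>down n\<close>, and that from a sibling with
  \<open>side n\<close>. The children of u are v, its m - 2 siblings, and (d - 1)(m - 1) vertices
  from other factors, for which the way through u is counted.\<close>

lemma down_bound:
  "p * (\<alpha> * (down n * down (Suc n)) + \<beta> * ((real m - 2) * (side n * down (Suc n)))
    + \<beta> * (1 + (real m - 2) * side n + (real d - 1) * (real m - 1) * (A * down (Suc n)))) \<le> down (Suc n)"
proof (rule down_ge)
  fix u v assume u: "u \<in> verts m d" "length u \<ge> Suc n" and v: "v \<in> kids m d u"
  let ?s = "side n" and ?r = "down (Suc n)"
  have une: "u \<noteq> []" using u by auto
  have bV: "butlast u \<in> verts m d" using verts_butlast[OF m2 u(1)] .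
  have bl: "length (butlast u) \<ge> n" using u by simp
  have bk: "u \<in> kids m d (butlast u)" using in_kids_iff[OF m2 bV] u une by simp
  have vV: "v \<in> verts m d" "v \<noteq> []" using v kids_in_verts[OF m2 u(1)] kids_butlast by auto
  have uv: "u \<noteq> v" using length_kids[OF v] by auto
  have r: "?r \<le> h u v" by (rule down_le[OF u v])
  have par: "down n * ?r \<le> h (butlast u) v"
    using mult_mono[OF down_le[OF bV bl bk] r] H_trans[OF bV u(1), of v] H_nonneg[OF bV] down_nonneg
    by (auto intro: order_trans)
  have sib: "(real m - 2) * (?s * ?r) \<le> (\<Sum>y\<in>siblings m u. h y v)"
    unfolding real_card_siblings[OF u(1) une, symmetric]
  proof (rule sum_ge_card)
    fix y assume y: "y \<in> siblings m u"
    then have yV: "y \<in> verts m d" using siblings_in_verts[OF m2 u(1) une] by auto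
    show "?s * ?r \<le> h y v"
      using mult_mono[OF side_le[OF bV bl bk, of y] r] H_trans[OF yV u(1), of v] H_nonneg[OF yV] down_nonneg y
      by (auto intro: order_trans)
  qed
  let ?rest = "kids m d u - insert v (siblings m v)"
  have vns: "v \<notin> siblings m v" using siblings_disjnt(4)[OF vV(2)] .
  have sub: "insert v (siblings m v) \<subseteq> kids m d u" using v kids_siblings[OF v] by auto
  have "(\<Sum>y\<in>kids m d u. h y v) = (\<Sum>y\<in>?rest. h y v) + (\<Sum>y\<in>insert v (siblings m v). h y v)"
    by (rule sum.subset_diff[OF sub]) simp
  moreover have "(\<Sum>y\<in>insert v (siblings m v). h y v) = 1 + (\<Sum>y\<in>siblings m v. h y v)"
    using vns by simp
  moreover have "(real m - 2) * ?s \<le> (\<Sum>y\<in>siblings m v. h y v)"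
    unfolding real_card_siblings[OF vV, symmetric]
    by (rule sum_ge_card) (rule side_le[OF u(1) _ v], use u in auto)
  moreover have "(real d - 1) * (real m - 1) * (A * ?r) \<le> (\<Sum>y\<in>?rest. h y v)"
  proof -
    have "card ?rest = card (kids m d u) - card (insert v (siblings m v))"
      using sub by (intro card_Diff_subset) auto
    moreover have "card (insert v (siblings m v)) \<le> card (kids m d u)" using sub by (intro card_mono) auto
    moreover have "card (insert v (siblings m v)) = Suc (card (siblings m v))" using vns by simp
    ultimately have "real (card ?rest) = real (card (kids m d u)) - (1 + real (card (siblings m v)))" by simp
    then have c: "real (card ?rest) = (real d - 1) * (real m - 1)"
      unfolding real_card_kids[OF u(1) une] real_card_siblings[OF vV] by (simp add: algebra_simps)
    show ?thesis unfolding c[symmetric]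
    proof (rule sum_ge_card)
      fix y assume y: "y \<in> ?rest"
      then have yv: "y \<in> verts m d" using kids_in_verts[OF m2 u(1)] by auto
      have "A * ?r \<le> h y u * h u v"
        using up_bounds[OF yv] kids_butlast[of y m d u] y A_le_up A_nonneg r down_nonneg
        by (intro mult_mono H_nonneg yv) auto
      also have "\<dots> \<le> h y v" by (rule H_trans[OF yv u(1)])
      finally show "A * ?r \<le> h y v" .
    qed
  qed
  ultimately have kid: "1 + (real m - 2) * ?s + (real d - 1) * (real m - 1) * (A * ?r) \<le> (\<Sum>y\<in>kids m d u. h y v)" by simp
  have "p * (\<alpha> * (down n * ?r) + \<beta> * ((real m - 2) * (?s * ?r)) + \<beta> * (1 + (real m - 2) * ?s + (real d - 1) * (real m - 1) * (A * ?r)))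
    \<le> p * (\<alpha> * h (butlast u) v + \<beta> * (\<Sum>y\<in>siblings m u. h y v) + \<beta> * (\<Sum>y\<in>kids m d u. h y v))"
    using sib kid par p01 \<beta>_pos \<alpha>01 by (intro mult_left_mono add_mono) auto
  then show "p * (\<alpha> * (down n * ?r) + \<beta> * ((real m - 2) * (?s * ?r)) + \<beta> * (1 + (real m - 2) * ?s + (real d - 1) * (real m - 1) * (A * ?r))) \<le> h u v"
    using h_expand[OF u(1) une uv] by simp
qed

text \<open>Eliminating \<open>side\<close> gives \<open>F(down n, down (n + 1)) \<le> down (n + 1)\<close>; in the limit this is the quadratic
  inequality \<open>Q \<rho>\<^sup>2 + R \<rho> + S \<ge> 0\<close> with \<open>Q < 0\<close>.\<close>

lemma down_tendsto: obtains \<rho> where "down \<longlonglongrightarrow> \<rho>" "0 \<le> \<rho>" "\<rho> \<le> 1" "B_fun m d \<alpha> p \<le> \<rho>"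
proof -
  have "convergent down"
    by (rule Bseq_mono_convergent[OF BseqI'[of _ 1]])
       (use down_nonneg down_le_1 lift_Suc_mono_le[of down] down_mono in auto)
  then obtain \<rho> where \<rho>: "down \<longlonglongrightarrow> \<rho>" by (auto simp: convergent_def)
  have \<rho>0: "0 \<le> \<rho>" by (rule LIMSEQ_le_const[OF \<rho>]) (simp add: down_nonneg)
  have \<rho>1: "\<rho> \<le> 1" by (rule LIMSEQ_le_const2[OF \<rho>]) (simp add: down_le_1)
  let ?g = "\<lambda>r. p * (\<alpha> * r + \<beta>) / \<gamma>"
  let ?F = "\<lambda>r r'. p * (\<alpha> * (r * r') + \<beta> * ((real m - 2) * (?g r * r'))
    + \<beta> * (1 + (real m - 2) * ?g r + (real d - 1) * (real m - 1) * (A * r')))"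
  have "?F (down n) (down (Suc n)) \<le> down (Suc n)" for n
  proof (rule order_trans[OF _ down_bound[of n]])
    have "?g (down n) \<le> side n" using side_bound[of n] \<gamma>_pos by (simp add: pos_divide_le_eq)
    then show "?F (down n) (down (Suc n)) \<le> p * (\<alpha> * (down n * down (Suc n)) + \<beta> * ((real m - 2) * (side n * down (Suc n)))
    + \<beta> * (1 + (real m - 2) * side n + (real d - 1) * (real m - 1) * (A * down (Suc n))))"
      using p01 \<beta>_pos m2 down_nonneg[of "Suc n"] by (intro mult_left_mono add_mono mult_right_mono order_refl) auto
  qed
  moreover have "(\<lambda>n. ?F (down n) (down (Suc n))) \<longlonglongrightarrow> ?F \<rho> \<rho>"
    by (intro tendsto_intros \<rho> LIMSEQ_Suc[OF \<rho>]) (use \<gamma>_pos in auto)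
  ultimately have "?F \<rho> \<rho> \<le> \<rho>"
    using LIMSEQ_le[OF _ LIMSEQ_Suc[OF \<rho>]] by blast
  then have "\<gamma> * ?F \<rho> \<rho> \<le> \<gamma> * \<rho>" using \<gamma>_pos by simp
  moreover have "\<gamma> * ?F \<rho> \<rho> = p * (\<gamma> * \<alpha> * \<rho>\<^sup>2 + \<beta> * (real m - 2) * (p * (\<alpha> * \<rho> + \<beta>)) * \<rho>
    + \<beta> * (\<gamma> + (real m - 2) * (p * (\<alpha> * \<rho> + \<beta>)) + (real d - 1) * (real m - 1) * A * \<gamma> * \<rho>))"
    using \<gamma>_pos by (simp add: field_simps power2_eq_square)
  ultimately have "(- Q_fun m d \<alpha> p) * \<rho>\<^sup>2 + (- R_fun m d \<alpha> p) * \<rho> + (- S_fun m d \<alpha> p) \<le> 0"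
    unfolding Q_fun_def R_fun_def S_fun_def Let_def
    by (simp add: algebra_simps power2_eq_square)
  \<comment> \<open>The sign of Q, strict because of the denominator of B, identifies B as the
    smaller root: its \<open>+ sqrt\<close> stands over the negative number 2Q.\<close>
  moreover have "- Q_fun m d \<alpha> p > 0"
  proof -
    have "- Q_fun m d \<alpha> p \<ge> 0"
      using \<alpha>01 p01 \<gamma>_pos \<beta>m mult_nonneg_nonneg[OF \<beta>m p01(1)] unfolding Q_fun_def by (simp add: mult_ac)
    then show ?thesis using B_den by (auto simp: B_den_def)
  qed
  ultimately have "B_fun m d \<alpha> p \<le> \<rho>"
    using ge_smaller_root[of "- Q_fun m d \<alpha> p" \<rho> "- R_fun m d \<alpha> p" "- S_fun m d \<alpha> p"]
    unfolding B_fun_def B_den_def by (simp add: minus_divide_left[symmetric] minus_divide_right[symmetric] diff_divide_distrib add_divide_distrib)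
  then show ?thesis using that \<rho> \<rho>0 \<rho>1 by blast
qed

text \<open>\<phi>(r) = d(m - 1)(1 - (1 - r)^2) increases on r \<le> 1. So \<phi>(\<rho>) \<ge>
  \<phi>(B) > 1 for the limit \<rho> of \<open>down\<close>, and by continuity \<open>down n\<close>
  itself satisfies the inequality for large n.\<close>

lemma ex_level:
  obtains r N where "0 < r" "r \<le> 1" "real d * (real m - 1) * (2 * r - r\<^sup>2) > 1" "N > 0"
    "\<And>u v. u \<in> verts m d \<Longrightarrow> length u \<ge> N \<Longrightarrow> v \<in> kids m d u \<Longrightarrow> r \<le> h u v"
proof -
  obtain \<rho> where \<rho>: "down \<longlonglongrightarrow> \<rho>" "0 \<le> \<rho>" "\<rho> \<le> 1" "B_fun m d \<alpha> p \<le> \<rho>" by (rule down_tendsto)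
  let ?B = "B_fun m d \<alpha> p"
  have c: "real d * (real m - 1) \<ge> 0" using m2 by simp
  have "(1 - \<rho>)\<^sup>2 \<le> (1 - ?B)\<^sup>2" using \<rho> by (intro power_mono) auto
  then have "real d * (real m - 1) * (2 * ?B - ?B\<^sup>2) \<le> real d * (real m - 1) * (2 * \<rho> - \<rho>\<^sup>2)"
    using c by (intro mult_left_mono) (auto simp: power2_eq_square algebra_simps)
  then have gt: "real d * (real m - 1) * (2 * \<rho> - \<rho>\<^sup>2) > 1"
    using \<phi>_gt_1 by (simp add: \<phi>_fun_def algebra_simps)
  have "(\<lambda>n. real d * (real m - 1) * (2 * down n - (down n)\<^sup>2)) \<longlonglongrightarrow> real d * (real m - 1) * (2 * \<rho> - \<rho>\<^sup>2)"
    by (intro tendsto_intros \<rho>)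
  then have "eventually (\<lambda>n. real d * (real m - 1) * (2 * down n - (down n)\<^sup>2) > 1) sequentially"
    using gt by (rule order_tendstoD)
  then obtain n0 where n0: "\<And>n. n \<ge> n0 \<Longrightarrow> real d * (real m - 1) * (2 * down n - (down n)\<^sup>2) > 1"
    by (auto simp: eventually_sequentially)
  \<comment> \<open>The successor makes N positive, which keeps the root and its larger number of
    children out of the later counts.\<close>
  define n where "n = Suc n0"
  have n: "real d * (real m - 1) * (2 * down n - (down n)\<^sup>2) > 1" using n0[of n] by (simp add: n_def)
  have "down n \<noteq> 0" using n by auto
  then have "0 < down n" using down_nonneg[of n] by simp
  then show ?thesis using that[of "down n" n] n down_le_1 down_le by (auto simp: n_def)
qed

end

section \<open>Relays and branching\<close>

text \<open>\<open>Q i j\<close> means that the frog of the \<open>i\<close>-th vertex of a path reaches the \<open>j\<close>-th one. In a step, \<open>i\<close> is the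
  last frog before \<open>j\<close> that advances at all; its uniqueness makes the union over \<open>i\<close> disjoint.\<close>

inductive reach :: "(nat \<Rightarrow> nat \<Rightarrow> bool) \<Rightarrow> nat \<Rightarrow> bool" for Q where
  reach_0: "reach Q 0"
| reach_step: "reach Q i \<Longrightarrow> i < j \<Longrightarrow> Q i j \<Longrightarrow> (\<forall>l\<in>{i<..<j}. \<not> Q l (Suc l)) \<Longrightarrow> reach Q j"

lemma reach_iff:
  "j > 0 \<Longrightarrow> reach Q j \<longleftrightarrow> (\<exists>i\<in>{..<j}. reach Q i \<and> Q i j \<and> (\<forall>l\<in>{i<..<j}. \<not> Q l (Suc l)))"
  by (subst reach.simps) auto

text \<open>Binomial expansion to first order with a generous quadratic remainder.\<close>

lemma power_one_minus_le:
  fixes \<epsilon> :: real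
  assumes "0 \<le> \<epsilon>" "\<epsilon> \<le> 1" shows "(1 - \<epsilon>) ^ n \<le> 1 - real n * \<epsilon> + (real n)\<^sup>2 * \<epsilon>\<^sup>2"
proof (induction n)
  case (Suc n)
  have "(1 - \<epsilon>) ^ Suc n \<le> (1 - real n * \<epsilon> + (real n)\<^sup>2 * \<epsilon>\<^sup>2) * (1 - \<epsilon>)"
    using mult_right_mono[OF Suc, of "1 - \<epsilon>"] assms by (simp add: mult.commute)
  also have "\<dots> = 1 - real (Suc n) * \<epsilon> + ((real n)\<^sup>2 + real n) * \<epsilon>\<^sup>2 - (real n)\<^sup>2 * (\<epsilon>\<^sup>2 * \<epsilon>)"
    by (simp add: algebra_simps power2_eq_square)
  also have "\<dots> \<le> 1 - real (Suc n) * \<epsilon> + (real (Suc n))\<^sup>2 * \<epsilon>\<^sup>2"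
    using assms by (simp add: algebra_simps power2_eq_square add_nonneg_nonneg)
  finally show ?case .
qed simp

context prob_space
begin

text \<open>If \<open>j\<close> has been reached through frog \<open>i\<close>, then \<open>j + 1\<close> is reached either because frog \<open>j\<close> advances or
  because it does not and frog \<open>i\<close>, independently, goes one step further.\<close>

lemma prob_reach_ge:
  fixes T :: "nat \<Rightarrow> nat \<Rightarrow> 'a \<Rightarrow> bool"
  assumes indep: "indep_sets G {..<k}"
    and T_in: "\<And>i j. i < j \<Longrightarrow> j \<le> k \<Longrightarrow> {\<omega> \<in> space M. T i j \<omega>} \<in> G i"
    and G_compl: "\<And>i B. i < k \<Longrightarrow> B \<in> G i \<Longrightarrow> space M - B \<in> G i"
    and nested: "\<And>i j \<omega>. i < j \<Longrightarrow> T i j \<omega> \<Longrightarrow> T i (Suc i) \<omega>"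
    and first: "\<And>i. i < k \<Longrightarrow> r \<le> prob {\<omega> \<in> space M. T i (Suc i) \<omega>}"
    and later: "\<And>i j. i < j \<Longrightarrow> j < k \<Longrightarrow>
      r * prob {\<omega> \<in> space M. T i j \<omega>} \<le> prob {\<omega> \<in> space M. T i (Suc j) \<omega>}"
    and r: "0 \<le> r" "r \<le> 1" and k: "k > 0"
  shows "r * (2 * r - r\<^sup>2) ^ (k - 1) \<le> prob {\<omega> \<in> space M. reach (\<lambda>i j. T i j \<omega>) k}"
proof -
  define E where "E j = {\<omega> \<in> space M. reach (\<lambda>i j. T i j \<omega>) j}" for j
  define t where "t i j = {\<omega> \<in> space M. T i j \<omega>}" for i j
  \<comment> \<open>\<open>F i j\<close> describes a step from i to j in \<open>reach\<close>: i is
    reached, frog i gets to j, and no frog strictly between advances. Apart from \<open>E i\<close>,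
    each condition concerns a single frog.\<close>
  define B where "B i j l = (if l = i then t i j else space M - t l (Suc l))" for i j l
  define F where "F i j = E i \<inter> (\<Inter>l\<in>{i..<j}. B i j l)" for i j
  have G_ev: "G i \<subseteq> events" if "i < k" for i
    using indep that by (auto simp: indep_sets_def)
  have t_G: "t i j \<in> G i" if "i < j" "j \<le> k" for i j
    using T_in[OF that] by (simp add: t_def)
  have B_G: "B i j l \<in> G l" if "i \<le> l" "l < j" "j \<le> k" for i j l
    using that t_G[of i j] G_compl[OF _ t_G[of l "Suc l"]] by (auto simp: B_def)
  have E_0: "E 0 = space M" by (auto simp: E_def reach_0)
  have E_F: "E j = (\<Union>i\<in>{..<j}. F i j)" if j: "j > 0" for j
  proof -
    have "\<omega> \<in> E j \<longleftrightarrow> (\<exists>i\<in>{..<j}. \<omega> \<in> F i j)" for \<omega>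
    proof (cases "\<omega> \<in> space M")
      case True
      have "\<omega> \<in> F i j \<longleftrightarrow> reach (\<lambda>i j. T i j \<omega>) i \<and> T i j \<omega> \<and> (\<forall>l\<in>{i<..<j}. \<not> T l (Suc l) \<omega>)" if "i < j" for i
      proof -
        have "{i..<j} = insert i {i<..<j}" using that by auto
        then have "\<omega> \<in> F i j \<longleftrightarrow> \<omega> \<in> E i \<and> \<omega> \<in> B i j i \<and> (\<forall>l\<in>{i<..<j}. \<omega> \<in> B i j l)"
          unfolding F_def by auto
        also have "(\<forall>l\<in>{i<..<j}. \<omega> \<in> B i j l) \<longleftrightarrow> (\<forall>l\<in>{i<..<j}. \<not> T l (Suc l) \<omega>)"
          using True by (intro ball_cong) (auto simp: B_def t_def)
        finally show ?thesis using True by (simp add: E_def B_def t_def)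
      qed
      then show ?thesis using True by (auto simp: E_def reach_iff[OF j])
    qed (auto simp: E_def F_def)
    then show ?thesis by auto
  qed
  have disj: "disjoint_family_on (\<lambda>i. F i j) {..<j}" for j
  proof -
    have False if "i < i'" "i' < j" "\<omega> \<in> F i j" "\<omega> \<in> F i' j" for i i' \<omega>
    proof -
      have "\<omega> \<in> B i j i'" "\<omega> \<in> B i' j i'" using that by (auto simp: F_def)
      then show False using that nested[of i' j \<omega>] by (auto simp: B_def t_def)
    qed
    then show ?thesis unfolding disjoint_family_on_def by (metis disjoint_iff lessThan_iff linorder_neqE_nat)
  qed
  \<comment> \<open>\<open>E j\<close> is decided by the frogs before j and is therefore independent
    of the later ones. The factors \<open>C l\<close> are arbitrary because the induction has to
    insert the conditions of \<open>F i j\<close> together with further events.\<close>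
  have main: "E j \<in> events \<and> (\<forall>L C. L \<subseteq> {j..<k} \<and> (\<forall>l\<in>L. C l \<in> G l) \<longrightarrow>
      prob (E j \<inter> (\<Inter>l\<in>L. C l)) = prob (E j) * (\<Prod>l\<in>L. prob (C l)))" if "j \<le> k" for j
    using that
  proof (induction j rule: less_induct)
    case (less j)
    show ?case
    proof (cases "j = 0")
      case True
      have "prob (E j \<inter> (\<Inter>l\<in>L. C l)) = prob (E j) * (\<Prod>l\<in>L. prob (C l))"
        if L: "L \<subseteq> {j..<k}" "\<forall>l\<in>L. C l \<in> G l" for L C
      proof (cases "L = {}")
        case False
        have fin: "finite L" using L finite_subset by blast
        obtain l where l: "l \<in> L" using False by blast
        then have "l < k" "C l \<in> G l" using L by auto
        then have "C l \<in> events" using G_ev[of l] by blast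
        then have "(\<Inter>l\<in>L. C l) \<subseteq> space M" using l sets.sets_into_space by blast
        then have "E j \<inter> (\<Inter>l\<in>L. C l) = (\<Inter>l\<in>L. C l)" using True E_0 by auto
        moreover have "prob (\<Inter>l\<in>L. C l) = (\<Prod>l\<in>L. prob (C l))"
        proof (rule indep_setsD[OF indep])
          show "L \<subseteq> {..<k}" using L(1) by force
        qed (use L False fin in auto)
        ultimately show ?thesis using True E_0 prob_space by simp
      qed simp
      then show ?thesis using True E_0 by auto
    next
      case False

      have FC: "F i j \<inter> (\<Inter>l\<in>L. C l) \<in> events"
        and PFC: "prob (F i j \<inter> (\<Inter>l\<in>L. C l)) = prob (E i) * (\<Prod>l\<in>{i..<j}. prob (B i j l)) * (\<Prod>l\<in>L. prob (C l))"
        if i: "i < j" and L: "L \<subseteq> {j..<k}" "\<forall>l\<in>L. C l \<in> G l" for i L C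
      proof -
        define D where "D l = (if l \<in> {i..<j} then B i j l else C l)" for l
        have fin: "finite L" using L finite_subset by blast
        have dj: "{i..<j} \<inter> L = {}" using L by auto
        have DG: "\<forall>l\<in>{i..<j} \<union> L. D l \<in> G l" using B_G i L less.prems by (auto simp: D_def)
        have sub: "{i..<j} \<union> L \<subseteq> {i..<k}" using L i less.prems by auto
        have eq: "F i j \<inter> (\<Inter>l\<in>L. C l) = E i \<inter> (\<Inter>l\<in>{i..<j} \<union> L. D l)"
        proof -
          have "(\<Inter>l\<in>{i..<j} \<union> L. D l) = (\<Inter>l\<in>{i..<j}. D l) \<inter> (\<Inter>l\<in>L. D l)"
            by (rule INT_Un)
          also have "(\<Inter>l\<in>{i..<j}. D l) = (\<Inter>l\<in>{i..<j}. B i j l)" by (intro INF_cong) (auto simp: D_def)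
          also have "(\<Inter>l\<in>L. D l) = (\<Inter>l\<in>L. C l)" using dj by (intro INF_cong) (auto simp: D_def)
          finally show ?thesis unfolding F_def by blast
        qed
        have IH: "E i \<in> events" "prob (E i \<inter> (\<Inter>l\<in>{i..<j} \<union> L. D l)) = prob (E i) * (\<Prod>l\<in>{i..<j} \<union> L. prob (D l))"
          using less.IH[OF i] i less.prems DG sub by simp_all
        have "(\<Prod>l\<in>{i..<j} \<union> L. prob (D l)) = (\<Prod>l\<in>{i..<j}. prob (D l)) * (\<Prod>l\<in>L. prob (D l))"
          using fin dj by (intro prod.union_disjoint) auto
        moreover have "(\<Prod>l\<in>L. prob (D l)) = (\<Prod>l\<in>L. prob (C l))"
          using dj by (intro prod.cong) (auto simp: D_def)
        moreover have "(\<Prod>l\<in>{i..<j}. prob (D l)) = (\<Prod>l\<in>{i..<j}. prob (B i j l))"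
          by (intro prod.cong) (auto simp: D_def)
        ultimately show "prob (F i j \<inter> (\<Inter>l\<in>L. C l)) = prob (E i) * (\<Prod>l\<in>{i..<j}. prob (B i j l)) * (\<Prod>l\<in>L. prob (C l))"
          using IH eq by simp
        have "D l \<in> events" if "l \<in> {i..<j} \<union> L" for l
        proof -
          have "l < k" "D l \<in> G l" using that sub DG by (auto simp del: Un_iff)
          then show ?thesis using G_ev[of l] by blast
        qed
        then have "(\<Inter>l\<in>{i..<j} \<union> L. D l) \<in> events" using i fin by (intro sets.finite_INT) auto
        then show "F i j \<inter> (\<Inter>l\<in>L. C l) \<in> events" unfolding eq using IH(1) by blast
      qed
      have F_ev: "F i j \<in> events" if "i < j" for i using FC[OF that, of "{}"] by simp
      have PF: "prob (F i j) = prob (E i) * (\<Prod>l\<in>{i..<j}. prob (B i j l))" if "i < j" for i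
        using PFC[OF that, of "{}"] by simp
      have "prob (E j \<inter> (\<Inter>l\<in>L. C l)) = prob (E j) * (\<Prod>l\<in>L. prob (C l))"
        if L: "L \<subseteq> {j..<k}" "\<forall>l\<in>L. C l \<in> G l" for L C
      proof -
        have "E j \<inter> (\<Inter>l\<in>L. C l) = (\<Union>i\<in>{..<j}. F i j \<inter> (\<Inter>l\<in>L. C l))" using E_F[of j] False by auto
        also have "prob \<dots> = (\<Sum>i\<in>{..<j}. prob (F i j \<inter> (\<Inter>l\<in>L. C l)))"
        proof (rule finite_measure_finite_Union)
          show "disjoint_family_on (\<lambda>i. F i j \<inter> (\<Inter>l\<in>L. C l)) {..<j}"
            using disj[of j] unfolding disjoint_family_on_def by blast
        qed (use FC[OF _ L] in auto)
        also have "\<dots> = (\<Sum>i\<in>{..<j}. prob (F i j)) * (\<Prod>l\<in>L. prob (C l))"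
          unfolding sum_distrib_right using PFC[OF _ L] PF by (intro sum.cong) simp_all
        also have "(\<Sum>i\<in>{..<j}. prob (F i j)) = prob (E j)"
          unfolding E_F[of j, OF neq0_conv[THEN iffD1, OF False]] using F_ev disj[of j]
          by (intro finite_measure_finite_Union[symmetric]) auto
        finally show ?thesis .
      qed
      moreover have "E j \<in> events" using E_F[of j] False F_ev by auto
      ultimately show ?thesis by blast
    qed
  qed
  have PF: "prob (F i j) = prob (E i) * (\<Prod>l\<in>{i..<j}. prob (B i j l))" if "i < j" "j \<le> k" for i j
  proof -
    have "i \<le> k" "{i..<j} \<subseteq> {i..<k}" "\<forall>l\<in>{i..<j}. B i j l \<in> G l" using that B_G by auto
    then show ?thesis unfolding F_def using main[of i] by blast
  qed
  have F_ev: "F i j \<in> events" if "i < j" "j \<le> k" for i j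
  proof -
    have "B i j l \<in> events" if "l \<in> {i..<j}" for l
    proof -
      have "l < k" "B i j l \<in> G l" using B_G[of i l j] that \<open>j \<le> k\<close> by auto
      then show ?thesis using G_ev[of l] by blast
    qed
    then have "(\<Inter>l\<in>{i..<j}. B i j l) \<in> events" using that by (intro sets.finite_INT) auto
    then show ?thesis unfolding F_def using main[of i] that by auto
  qed
  have PE: "prob (E j) = (\<Sum>i<j. prob (F i j))" if "0 < j" "j \<le> k" for j
    unfolding E_F[OF that(1)] using F_ev that disj[of j]
    by (intro finite_measure_finite_Union) auto
  have step: "prob (E j) * (2 * r - r\<^sup>2) \<le> prob (E (Suc j))" if j: "0 < j" "Suc j \<le> k" for j
  proof -
    let ?t = "prob (t j (Suc j))"
    have tev: "t j (Suc j) \<in> events" using t_G[of j "Suc j"] G_ev[of j] j by auto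
    have "(1 - ?t) * r * prob (F i j) \<le> prob (F i (Suc j))" if i: "i < j" for i
    proof -
      have s1: "{i..<j} = insert i {i<..<j}" "{i..<Suc j} = insert i (insert j {i<..<j})" using i by auto
      have "prob (F i j) = prob (E i) * (prob (t i j) * (\<Prod>l\<in>{i<..<j}. prob (space M - t l (Suc l))))"
        using PF[of i j] i j unfolding s1 by (simp add: B_def)
      moreover have "prob (F i (Suc j)) = prob (E i) * (prob (t i (Suc j)) * ((1 - ?t) * (\<Prod>l\<in>{i<..<j}. prob (space M - t l (Suc l)))))"
        using PF[of i "Suc j"] i j prob_compl[OF tev] unfolding s1 by (simp add: B_def)
      moreover have "r * prob (t i j) \<le> prob (t i (Suc j))" using later[of i j] i j by (simp add: t_def)
      then have "prob (E i) * ((r * prob (t i j)) * ((1 - ?t) * (\<Prod>l\<in>{i<..<j}. prob (space M - t l (Suc l)))))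
        \<le> prob (E i) * (prob (t i (Suc j)) * ((1 - ?t) * (\<Prod>l\<in>{i<..<j}. prob (space M - t l (Suc l)))))"
        by (intro mult_left_mono mult_right_mono mult_nonneg_nonneg prod_nonneg) auto
      ultimately show ?thesis by (simp add: mult_ac)
    qed
    then have "(\<Sum>i<j. (1 - ?t) * r * prob (F i j)) \<le> (\<Sum>i<j. prob (F i (Suc j)))" by (intro sum_mono) auto
    moreover have "prob (F j (Suc j)) = prob (E j) * ?t" using PF[of j "Suc j"] j by (simp add: B_def)
    ultimately have "(1 - ?t) * r * prob (E j) + prob (E j) * ?t \<le> prob (E (Suc j))"
      using PE[of j] PE[of "Suc j"] j by (simp add: sum_distrib_left)
    \<comment> \<open>As a function of t, the expression (1 - t) r + t is nondecreasing and equals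
      2r - r^2 at t = r.\<close>
    moreover have "r * (1 - r) \<le> ?t * (1 - r)" using first[of j] r j by (intro mult_right_mono) (auto simp: t_def)
    then have "prob (E j) * (2 * r - r\<^sup>2) \<le> prob (E j) * ((1 - ?t) * r + ?t)"
      by (intro mult_left_mono) (auto simp: algebra_simps power2_eq_square)
    ultimately show ?thesis by (simp add: algebra_simps)
  qed
  have "r * (2 * r - r\<^sup>2) ^ j \<le> prob (E (Suc j))" if "Suc j \<le> k" for j
    using that
  proof (induction j)
    case 0
    have "prob (E 1) = prob (F 0 1)" using PE[of 1] 0 by simp
    also have "\<dots> = prob (t 0 1)" using PF[of 0 1] 0 E_0 prob_space by (simp add: B_def)
    finally show ?case using first[of 0] 0 by (simp add: t_def)
  next
    case (Suc j)
    have "r * r \<le> r * 1" using r by (intro mult_left_mono) auto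
    then have "0 \<le> 2 * r - r\<^sup>2" using r by (simp add: power2_eq_square)
    then have "r * (2 * r - r\<^sup>2) ^ j * (2 * r - r\<^sup>2) \<le> prob (E (Suc j)) * (2 * r - r\<^sup>2)"
      using Suc by (intro mult_right_mono) auto
    also have "\<dots> \<le> prob (E (Suc (Suc j)))" using step[of "Suc j"] Suc by simp
    finally show ?case by (simp add: mult_ac)
  qed
  from this[of "k - 1"] show ?thesis using k by (simp add: E_def)
qed

text \<open>With \<open>X\<close> the number of \<open>v\<close> for which \<open>D v\<close> occurs, the complement has probability at most
  \<open>E (1 - \<epsilon>)^X \<le> 1 - \<epsilon> E X + \<epsilon>\<^sup>2 (card V)\<^sup>2\<close>.\<close>

lemma prob_branching_ge:
  assumes fin: "finite V"
    and indep: "indep_sets (case_option G0 G) (insert None (Some ` V))"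
    and G0: "sigma_algebra (space M) G0"
    and D: "\<And>v. v \<in> V \<Longrightarrow> D v \<in> G0"
    and C: "\<And>v. v \<in> V \<Longrightarrow> C v \<in> events \<and> space M - C v \<in> G v"
    and \<epsilon>: "0 \<le> \<epsilon>" "\<epsilon> \<le> 1" and C_ge: "\<And>v. v \<in> V \<Longrightarrow> \<epsilon> \<le> prob (C v)"
    and \<mu>: "\<mu> \<le> (\<Sum>v\<in>V. prob (D v))" "(real (card V))\<^sup>2 * \<epsilon> \<le> \<mu> - 1"
  shows "\<epsilon> \<le> prob (\<Union>v\<in>V. D v \<inter> C v)"
proof -
  interpret G0: sigma_algebra "space M" G0 by fact
  have G0_ev: "G0 \<subseteq> events" using indep by (auto simp: indep_sets_def)
  \<comment> \<open>\<open>A T\<close> says that T is exactly the set of v for which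
    \<open>D v\<close> occurs. These events partition the space and lie in \<open>G0\<close>, so the
    events \<open>C v\<close> are independent of each of them.\<close>
  define A where "A T = {\<omega> \<in> space M. {v \<in> V. \<omega> \<in> D v} = T}" for T
  have A_G0: "A T \<in> G0" if "T \<subseteq> V" for T
  proof -
    have "A T = space M \<inter> (\<Inter>v\<in>V. if v \<in> T then D v else space M - D v)"
      using that by (auto simp: A_def split: if_splits)
    moreover have "(\<Inter>v\<in>V. if v \<in> T then D v else space M - D v) \<in> G0" if "V \<noteq> {}"
      using fin that D by (intro G0.finite_INT) auto
    ultimately show ?thesis by (cases "V = {}") auto
  qed
  have A_disj: "T \<noteq> T' \<Longrightarrow> A T \<inter> A T' = {}" for T T' by (auto simp: A_def)
  have sumA: "(\<Sum>T\<in>Pow V. prob (A T)) = 1"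
  proof -
    have "(\<Sum>T\<in>Pow V. prob (A T)) = prob (\<Union>T\<in>Pow V. A T)"
      using fin A_G0 G0_ev A_disj by (intro finite_measure_finite_Union[symmetric]) (auto simp: disjoint_family_on_def)
    also have "(\<Union>T\<in>Pow V. A T) = space M"
    proof
      show "space M \<subseteq> (\<Union>T\<in>Pow V. A T)"
      proof
        fix \<omega> assume "\<omega> \<in> space M"
        then show "\<omega> \<in> (\<Union>T\<in>Pow V. A T)"
          by (intro UN_I[of "{v \<in> V. \<omega> \<in> D v}"]) (auto simp: A_def)
      qed
    qed (auto simp: A_def)
    finally show ?thesis by (simp add: prob_space)
  qed
  have PD: "prob (D v) = (\<Sum>T\<in>Pow V. if v \<in> T then prob (A T) else 0)" if v: "v \<in> V" for v
  proof -
    have "D v \<subseteq> space M" using D[OF v] G0.sets_into_space by auto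
    have "D v = (\<Union>T\<in>{T\<in>Pow V. v \<in> T}. A T)"
    proof
      show "D v \<subseteq> (\<Union>T\<in>{T\<in>Pow V. v \<in> T}. A T)"
      proof
        fix \<omega> assume "\<omega> \<in> D v"
        then show "\<omega> \<in> (\<Union>T\<in>{T\<in>Pow V. v \<in> T}. A T)" using v \<open>D v \<subseteq> space M\<close>
          by (intro UN_I[of "{v \<in> V. \<omega> \<in> D v}"]) (auto simp: A_def)
      qed
    qed (auto simp: A_def)
    then have "prob (D v) = prob (\<Union>T\<in>{T\<in>Pow V. v \<in> T}. A T)" by (rule arg_cong)
    also have "\<dots> = (\<Sum>T\<in>{T\<in>Pow V. v \<in> T}. prob (A T))"
      using fin A_G0 G0_ev A_disj by (intro finite_measure_finite_Union) (auto simp: disjoint_family_on_def)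
    also have "\<dots> = (\<Sum>T\<in>Pow V. if v \<in> T then prob (A T) else 0)"
      using fin by (intro sum.inter_filter) simp
    finally show ?thesis .
  qed
  have "(\<Sum>v\<in>V. prob (D v)) = (\<Sum>v\<in>V. \<Sum>T\<in>Pow V. if v \<in> T then prob (A T) else 0)"
    by (rule sum.cong[OF refl PD])
  also have "\<dots> = (\<Sum>T\<in>Pow V. \<Sum>v\<in>V. if v \<in> T then prob (A T) else 0)" by (rule sum.swap)
  also have "\<dots> = (\<Sum>T\<in>Pow V. real (card T) * prob (A T))"
  proof (rule sum.cong)
    fix T assume "T \<in> Pow V"
    then have "{v \<in> V. v \<in> T} = T" by auto
    then show "(\<Sum>v\<in>V. if v \<in> T then prob (A T) else 0) = real (card T) * prob (A T)"
      using fin by (simp add: sum.inter_filter[symmetric])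
  qed simp
  finally have mean: "\<mu> \<le> (\<Sum>T\<in>Pow V. real (card T) * prob (A T))" using \<mu> by simp
  let ?U = "\<Union>v\<in>V. D v \<inter> C v"
  let ?X = "\<lambda>T. A T \<inter> (\<Inter>v\<in>T. space M - C v)"
  have U: "?U \<in> events" using fin D G0_ev C by (intro sets.finite_UN sets.Int) auto
  have X_ev: "?X T \<in> events" if "T \<subseteq> V" for T
  proof (cases "T = {}")
    case False
    then have "(\<Inter>v\<in>T. space M - C v) \<in> events"
      using that fin C by (intro sets.finite_INT) (auto intro: finite_subset)
    moreover have "A T \<in> events" using A_G0[OF that] G0_ev by blast
    ultimately show ?thesis by blast
  qed (use A_G0 that G0_ev in auto)
  have "space M - ?U = (\<Union>T\<in>Pow V. ?X T)"
  proof
    show "space M - ?U \<subseteq> (\<Union>T\<in>Pow V. ?X T)"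
    proof
      fix \<omega> assume "\<omega> \<in> space M - ?U"
      then show "\<omega> \<in> (\<Union>T\<in>Pow V. ?X T)"
        by (intro UN_I[of "{v \<in> V. \<omega> \<in> D v}"]) (auto simp: A_def)
    qed
  qed (unfold A_def, blast)
  then have "prob (space M - ?U) = (\<Sum>T\<in>Pow V. prob (?X T))"
  proof (rule ssubst, intro finite_measure_finite_Union)
    show "disjoint_family_on ?X (Pow V)"
      unfolding disjoint_family_on_def using A_disj by blast
    show "?X ` Pow V \<subseteq> events" using X_ev by blast
  qed (use fin in simp)
  also have "\<dots> \<le> (\<Sum>T\<in>Pow V. prob (A T) * (1 - real (card T) * \<epsilon> + (real (card V))\<^sup>2 * \<epsilon>\<^sup>2))"
  proof (rule sum_mono)
    fix T assume T: "T \<in> Pow V"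
    then have finT: "finite T" using fin finite_subset by blast
    let ?Y = "case_option (A T) (\<lambda>v. space M - C v)"
    have "prob (\<Inter>j\<in>insert None (Some ` T). ?Y j) = (\<Prod>j\<in>insert None (Some ` T). prob (?Y j))"
      using T finT A_G0 C by (intro indep_setsD[OF indep]) auto
    then have "prob (?X T) = prob (A T) * (\<Prod>v\<in>T. prob (space M - C v))"
      using finT by (simp add: prod.reindex)
    also have "(\<Prod>v\<in>T. prob (space M - C v)) \<le> (\<Prod>v\<in>T. 1 - \<epsilon>)"
      using T C C_ge by (intro prod_mono) (auto simp: prob_compl subset_iff)
    also have "(\<Prod>v\<in>T. 1 - \<epsilon>) \<le> 1 - real (card T) * \<epsilon> + (real (card T))\<^sup>2 * \<epsilon>\<^sup>2"
      using power_one_minus_le[OF \<epsilon>] by simp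
    also have "\<dots> \<le> 1 - real (card T) * \<epsilon> + (real (card V))\<^sup>2 * \<epsilon>\<^sup>2"
      using T fin by (intro add_left_mono mult_right_mono power_mono) (auto intro: card_mono)
    finally show "prob (?X T) \<le> prob (A T) * (1 - real (card T) * \<epsilon> + (real (card V))\<^sup>2 * \<epsilon>\<^sup>2)"
      by (simp add: mult_left_mono)
  qed
  also have "\<dots> = (\<Sum>T\<in>Pow V. prob (A T)) * (1 + (real (card V))\<^sup>2 * \<epsilon>\<^sup>2) - \<epsilon> * (\<Sum>T\<in>Pow V. real (card T) * prob (A T))"
    unfolding sum_distrib_left sum_distrib_right sum_subtractf[symmetric]
    by (intro sum.cong) (simp_all add: algebra_simps)
  also have "\<dots> \<le> 1 + (real (card V))\<^sup>2 * \<epsilon>\<^sup>2 - \<epsilon> * \<mu>"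
    using mean \<epsilon> mult_left_mono[OF mean, of \<epsilon>] by (simp add: sumA)
  \<comment> \<open>The second assumption on \<mu>, multiplied by \<epsilon>, absorbs the quadratic
    term.\<close>
  also have "\<dots> \<le> 1 - \<epsilon>"
    using mult_left_mono[OF \<mu>(2) \<epsilon>(1)] by (simp add: power2_eq_square algebra_simps)
  finally show ?thesis using prob_compl[OF U] by simp
qed

end

section \<open>The frog dynamics\<close>

context
  fixes V :: "'v set" and r :: 'v and s :: "'v \<Rightarrow> nat \<Rightarrow> 'v" and l :: "'v \<Rightarrow> enat"
begin

abbreviation (input) "age \<equiv> frog_age V r s l"

definition awake :: "'v \<Rightarrow> bool" where
  "awake v \<longleftrightarrow> (\<exists>t k. frog_age V r s l t v = Some k)"

lemma age_add: "age t v = Some k \<Longrightarrow> age (t + j) v = Some (k + j)"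
  by (induction j) auto

lemma age_woken: "age t v = Some k \<Longrightarrow> \<exists>t0. age t0 v = Some 0"
proof (induction t arbitrary: k)
  case 0 then show ?case by (intro exI[of _ 0]) (auto split: if_splits)
next
  case (Suc t)
  show ?case
  proof (cases "age t v")
    case None
    with Suc.prems have "k = 0" by (auto split: if_splits)
    then show ?thesis using Suc.prems by blast
  qed (use Suc.IH in blast)
qed

lemma awake_root: "awake r"
  unfolding awake_def by (intro exI[of _ 0]) simp

text \<open>Time 0 is excluded because a frog wakes others only from its first step on.\<close>

lemma awake_visit:
  assumes "awake u" "0 < k" "enat k < l u" "s u k \<in> V"
  shows "awake (s u k)"
proof -
  obtain j where j: "k = Suc j" using assms by (cases k) auto
  obtain t0 where "age t0 u = Some 0" using assms age_woken unfolding awake_def by blast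
  from age_add[OF this, of j] have t: "age (t0 + j) u = Some j" by simp
  have "\<exists>a. age (Suc (t0 + j)) (s u k) = Some a"
    using t assms j by (auto split: option.split)
  then show ?thesis unfolding awake_def by blast
qed

lemma finite_dom_age: "finite (dom (age t))"
proof (induction t)
  case (Suc t)
  have "dom (age (Suc t)) \<subseteq> dom (age t) \<union> (\<lambda>u. s u (Suc (the (age t u)))) ` dom (age t)"
  proof
    fix v assume "v \<in> dom (age (Suc t))"
    then consider "v \<in> dom (age t)" | u k where "age t u = Some k" "v = s u (Suc k)"
      by (cases "age t v") (auto split: if_splits)
    then show "v \<in> dom (age t) \<union> (\<lambda>u. s u (Suc (the (age t u)))) ` dom (age t)"
    proof cases
      case (2 u k)
      then show ?thesis by (intro UnI2 image_eqI[of _ _ u]) auto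
    qed auto
  qed
  then show ?case by (rule finite_subset) (use Suc in auto)
next
  case 0
  have "dom (age 0) \<subseteq> {r}" by (auto split: if_splits)
  then show ?case by (rule finite_subset) simp
qed

text \<open>Once no particle is active, nobody is woken any more: ages only increase, and those of
  dead particles stay beyond their lifetimes.\<close>

lemma dom_age_eq:
  assumes "\<forall>v k. age t v = Some k \<longrightarrow> \<not> enat k < l v"
  shows "dom (age (t + j)) = dom (age t) \<and> (\<forall>v k. age (t + j) v = Some k \<longrightarrow> \<not> enat k < l v)"
proof (induction j)
  case (Suc j)
  have "\<not> enat (Suc k) < l u" if "age (t + j) u = Some k" for u k
    using Suc that by (metis enat_ord_simps(2) lessI less_trans)
  then have eq: "age (t + Suc j) = (\<lambda>v. map_option Suc (age (t + j) v))"
    by (auto split: option.split simp: fun_eq_iff)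
  then have "dom (age (t + Suc j)) = dom (age (t + j))" by (auto simp: dom_def)
  moreover have "\<not> enat k < l v" if k: "age (t + Suc j) v = Some k" for v k
  proof -
    obtain k' where "age (t + j) v = Some k'" "k = Suc k'"
      using k unfolding eq by auto
    then show ?thesis using Suc by (metis enat_ord_simps(2) lessI less_trans)
  qed
  ultimately show ?case using Suc by simp
qed (use assms in auto)

text \<open>If no particle were active at time t, every vertex ever woken would belong to the finite
  set of those woken by time t.\<close>

lemma frogs_survive_if_infinite_awake:
  assumes "infinite {v. awake v}" shows "frogs_survive V r s l"
proof (rule ccontr)
  assume "\<not> frogs_survive V r s l"
  then obtain t where t: "\<forall>v k. age t v = Some k \<longrightarrow> \<not> enat k < l v"
    by (auto simp: frogs_survive_def)
  have "v \<in> dom (age t)" if "awake v" for v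
  proof -
    obtain t' k where "age t' v = Some k" using \<open>awake v\<close> awake_def by blast
    from age_add[OF this, of t] have "v \<in> dom (age (t + t'))" by (auto simp: add.commute)
    then show ?thesis using dom_age_eq[OF t] by simp
  qed
  then have "{v. awake v} \<subseteq> dom (age t)" by auto
  then show False using assms finite_dom_age finite_subset by blast
qed

end

context frog_model
begin

lemma frog_age_verts:
  assumes "m \<ge> 2"
  shows "frog_age (verts m d) (rt m d) s l t u = Some k \<Longrightarrow> u \<in> verts m d"
proof (induction t arbitrary: u k)
  case 0 then show ?case using assms
    by (auto simp: cyclic_free_product_def free_product_def split: if_splits)
qed (auto split: option.splits if_splits)

text \<open>Measurability of walks and lifetimes is available for vertices of the graph only, so u
  \<in> \<open>verts m d\<close> is made part of the waking condition.\<close>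

lemma frog_age_pred:
  "Measurable.pred M (\<lambda>\<omega>. frog_age (verts m d) (rt m d) (\<lambda>u n. S u n \<omega>) (\<lambda>u. \<Xi> u \<omega>) t v = Some k)"
  if m2: "m \<ge> 2"
proof (induction t arbitrary: v k)
  case (Suc t)
  let ?age = "\<lambda>\<omega>. frog_age (verts m d) (rt m d) (\<lambda>u n. S u n \<omega>) (\<lambda>u. \<Xi> u \<omega>)"
  note V = frog_age_verts[OF m2]
  have eq: "?age \<omega> (Suc t) v = Some k \<longleftrightarrow> (\<exists>j. k = Suc j \<and> ?age \<omega> t v = Some j) \<or>
    (k = 0 \<and> v \<in> verts m d \<and> (\<forall>j. \<not> ?age \<omega> t v = Some j) \<and>
      (\<exists>u j. u \<in> verts m d \<and> ?age \<omega> t u = Some j \<and> enat (Suc j) < \<Xi> u \<omega> \<and> S u (Suc j) \<omega> = v))" for \<omega>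
    using V[of "\<lambda>u n. S u n \<omega>" "\<lambda>u. \<Xi> u \<omega>" t] by (auto split: option.splits)
  have [measurable]: "Measurable.pred M (\<lambda>\<omega>. u \<in> verts m d \<and> ?age \<omega> t u = Some j \<and> enat (Suc j) < \<Xi> u \<omega> \<and> S u (Suc j) \<omega> = v)" for u j
  proof (cases "u \<in> verts m d")
    case True
    note [measurable] = Suc.IH walk_measurable[OF True] lifetime_measurable[OF True]
    show ?thesis by measurable
  qed simp
  note [measurable] = Suc.IH
  show ?case unfolding eq by measurable
qed simp

text \<open>A set that is not an event has \<open>measure\<close> 0, so the final comparison of
  probabilities depends on this.\<close>

lemma survival_event: "m \<ge> 2 \<Longrightarrow> survival \<in> events"
proof -
  assume m2: "m \<ge> 2"
  let ?age = "\<lambda>\<omega>. frog_age (verts m d) (rt m d) (\<lambda>u n. S u n \<omega>) (\<lambda>u. \<Xi> u \<omega>)"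
  have [measurable]: "Measurable.pred M (\<lambda>\<omega>. u \<in> verts m d \<and> ?age \<omega> t u = Some k \<and> enat k < \<Xi> u \<omega>)" for t u k
  proof (cases "u \<in> verts m d")
    case True
    note [measurable] = frog_age_pred[OF m2] lifetime_measurable[OF True]
    show ?thesis by measurable
  qed simp
  have "survival = {\<omega> \<in> space M. \<forall>t. \<exists>u k. u \<in> verts m d \<and> ?age \<omega> t u = Some k \<and> enat k < \<Xi> u \<omega>}"
    unfolding survival_def frogs_survive_def using frog_age_verts[OF m2] by blast
  also have "\<dots> \<in> events" by measurable
  finally show ?thesis .
qed

end

section \<open>The law of a single frog\<close>

text \<open>The path event matching \<^const>\<open>hit\<close>: from time \<open>i\<close> on, the frog visits \<open>vs\<close> in this order within \<open>n\<close>
  steps and while it is alive.\<close>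

fun visits :: "(nat \<Rightarrow> 'v) \<Rightarrow> enat \<Rightarrow> nat \<Rightarrow> nat \<Rightarrow> 'v list \<Rightarrow> bool" where
  "visits s l i n [] \<longleftrightarrow> enat i < l"
| "visits s l i n (v # vs) \<longleftrightarrow> (if s i = v then visits s l i n vs
     else case n of 0 \<Rightarrow> False | Suc k \<Rightarrow> visits s l (Suc i) k (v # vs))"

declare visits.simps(2) [simp del]

lemma visits_same [simp]: "s i = v \<Longrightarrow> visits s l i n (v # vs) \<longleftrightarrow> visits s l i n vs"
  and visits_0 [simp]: "s i \<noteq> v \<Longrightarrow> \<not> visits s l i 0 (v # vs)"
  and visits_Suc [simp]: "s i \<noteq> v \<Longrightarrow> visits s l i (Suc k) (v # vs) \<longleftrightarrow> visits s l (Suc i) k (v # vs)"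
  by (simp_all add: visits.simps(2))

lemma visits_alive: "visits s l i n vs \<Longrightarrow> enat i < l"
proof (induction s l i n vs rule: visits.induct)
  case (2 s l i n v vs)
  then show ?case
    by (cases "s i = v"; cases n) (auto intro: less_trans[of "enat i" "enat (Suc i)"])
qed simp

lemma visits_append: "visits s l i n (vs @ ws) \<Longrightarrow> visits s l i n vs"
proof (induction s l i n vs rule: visits.induct)
  case (2 s l i n v vs)
  then show ?case by (cases "s i = v"; cases n) auto
qed (auto dest: visits_alive)

lemma visits_mono: "visits s l i n vs \<Longrightarrow> n \<le> n' \<Longrightarrow> visits s l i n' vs"
proof (induction s l i n vs arbitrary: n' rule: visits.induct)
  case (2 s l i n v vs)
  show ?case
  proof (cases "s i = v")
    case True then show ?thesis using 2 by simp
  next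
    case False
    then obtain k where k: "n = Suc k" using 2(3) by (cases n) auto
    moreover obtain k' where "n' = Suc k'" "k \<le> k'" using 2(4) k by (cases n') auto
    ultimately show ?thesis using 2(2)[OF False k, of k'] 2(3) False by simp
  qed
qed simp

lemma visits_visit:
  "visits s l i n vs \<Longrightarrow> v \<in> set vs \<Longrightarrow> \<exists>k. enat k < l \<and> s k = v"
proof (induction s l i n vs rule: visits.induct)
  case (2 s l i n w vs)
  then show ?case using visits_alive[of s l i n vs] by (cases "s i = w"; cases n) auto
qed simp

lemma pred_visits:
  assumes [measurable]: "\<And>k. X k \<in> measurable N (count_space UNIV)" "L \<in> measurable N (count_space UNIV)"
  shows "Measurable.pred N (\<lambda>\<omega>. visits (\<lambda>k. (X k \<omega>) :: 'v :: countable) (L \<omega>) i n vs)"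
proof (induction "n + length vs" arbitrary: i n vs rule: less_induct)
  case less
  show ?case
  proof (cases vs)
    case (Cons v ws)
    have [measurable]: "Measurable.pred N (\<lambda>\<omega>. visits (\<lambda>k. X k \<omega>) (L \<omega>) i n ws)"
      using less Cons by simp
    have [measurable]: "Measurable.pred N (\<lambda>\<omega>. case n of 0 \<Rightarrow> False | Suc k \<Rightarrow> visits (\<lambda>k. X k \<omega>) (L \<omega>) (Suc i) k vs)"
      using less by (cases n) auto
    have "visits (\<lambda>k. X k \<omega>) (L \<omega>) i n vs \<longleftrightarrow> (if X i \<omega> = v then visits (\<lambda>k. X k \<omega>) (L \<omega>) i n ws
        else case n of 0 \<Rightarrow> False | Suc k \<Rightarrow> visits (\<lambda>k. X k \<omega>) (L \<omega>) (Suc i) k vs)" for \<omega>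
      unfolding Cons by (rule visits.simps(2))
    then show ?thesis by simp
  qed simp
qed

locale frog_tree = frog_model M m d \<alpha> p S \<Xi> + tree_walk m d \<alpha> p
  for M :: "'w measure" and m d :: nat and \<alpha> p :: real and S :: "vertex \<Rightarrow> nat \<Rightarrow> 'w \<Rightarrow> vertex"
    and \<Xi> :: "vertex \<Rightarrow> 'w \<Rightarrow> enat"
begin

section \<open>Sigma-algebras of sets of frogs and their independence\<close>

definition frog_sets :: "vertex + vertex \<Rightarrow> 'w set set" where
  "frog_sets = case_sum
     (\<lambda>u. sets (vimage_algebra (space M) (\<lambda>\<omega> n. S u n \<omega>) (Pi\<^sub>M UNIV (\<lambda>_. count_space UNIV))))
     (\<lambda>u. sets (vimage_algebra (space M) (\<Xi> u) (count_space UNIV)))"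

lemma S_frog_sets: "{\<omega> \<in> space M. S u n \<omega> \<in> B} \<in> frog_sets (Inl u)"
proof -
  have "(\<lambda>f. f n) \<in> measurable (Pi\<^sub>M UNIV (\<lambda>_::nat. count_space (UNIV :: vertex set))) (count_space UNIV)"
    by (rule measurable_component_singleton) simp
  from measurable_sets[OF this, of B]
  have "{f. f n \<in> B} \<in> sets (Pi\<^sub>M UNIV (\<lambda>_::nat. count_space (UNIV :: vertex set)))"
    by (simp add: space_PiM vimage_def)
  from in_vimage_algebra[OF this, of "\<lambda>\<omega> n. S u n \<omega>" "space M"]
  show ?thesis by (simp add: frog_sets_def vimage_def Int_def conj_commute)
qed

lemma \<Xi>_frog_sets: "{\<omega> \<in> space M. \<Xi> u \<omega> \<in> B} \<in> frog_sets (Inr u)"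
  using in_vimage_algebra[of B "count_space UNIV" "\<Xi> u" "space M"]
  by (simp add: frog_sets_def vimage_def Int_def conj_commute)

text \<open>It consists of the events determined by the walks and lifetimes of the frogs in X. As in
  the independence assumption, the two summands of \<open>X <+> X\<close> index the walks and the
  lifetimes.\<close>

definition frog_algebra :: "vertex set \<Rightarrow> 'w measure" where
  "frog_algebra X = sigma (space M) (\<Union>i\<in>X <+> X. frog_sets i)"

lemma frog_sets_Pow: "frog_sets i \<subseteq> Pow (space M)"
proof -
  have "B \<subseteq> space M" if "B \<in> frog_sets i" for B
  proof (cases i)
    case (Inl a)
    then show ?thesis using that sets.sets_into_space unfolding frog_sets_def sum.case by fastforce
  next
    case (Inr a)
    then show ?thesis using that sets.sets_into_space unfolding frog_sets_def sum.case by fastforce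
  qed
  then show ?thesis by auto
qed

lemma space_frog_algebra [simp]: "space (frog_algebra X) = space M"
  unfolding frog_algebra_def by (rule space_measure_of) (use frog_sets_Pow in blast)

lemma sets_frog_algebra: "sets (frog_algebra X) = sigma_sets (space M) (\<Union>i\<in>X <+> X. frog_sets i)"
  unfolding frog_algebra_def by (rule sets_measure_of) (use frog_sets_Pow in blast)

lemma sets_frog_algebra_mono: "X \<subseteq> Y \<Longrightarrow> sets (frog_algebra X) \<subseteq> sets (frog_algebra Y)"
  unfolding sets_frog_algebra by (rule sigma_sets_mono') auto

lemma pred_frog_algebra_mono:
  assumes "Measurable.pred (frog_algebra X) P" "X \<subseteq> Y" shows "Measurable.pred (frog_algebra Y) P"
  using assms sets_frog_algebra_mono[of X Y] unfolding pred_def by auto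

lemma S_measurable_frog_algebra: "u \<in> X \<Longrightarrow> S u n \<in> measurable (frog_algebra X) (count_space UNIV)"
  using S_frog_sets[of u n]
  by (auto intro!: measurableI sigma_sets.Basic bexI[of _ "Inl u"] simp: sets_frog_algebra vimage_def Int_def conj_commute)

lemma \<Xi>_measurable_frog_algebra: "u \<in> X \<Longrightarrow> \<Xi> u \<in> measurable (frog_algebra X) (count_space UNIV)"
  using \<Xi>_frog_sets[of u]
  by (auto intro!: measurableI sigma_sets.Basic bexI[of _ "Inr u"] simp: sets_frog_algebra vimage_def Int_def conj_commute)

lemma indep_frogs:
  assumes X: "\<And>j. j \<in> J \<Longrightarrow> X j \<subseteq> verts m d" and disj: "disjoint_family_on X J"
  shows "indep_sets (\<lambda>j. sets (frog_algebra (X j))) J"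
  unfolding sets_frog_algebra
proof (rule indep_sets_collect_sigma)
  show "indep_sets frog_sets (\<Union>j\<in>J. X j <+> X j)"
    unfolding frog_sets_def by (rule indep_sets_mono_index[OF _ independence]) (use X in auto)
  show "Int_stable (frog_sets i)" for i
    by (cases i) (simp_all add: frog_sets_def sets.Int_stable)
  show "disjoint_family_on (\<lambda>j. X j <+> X j) J"
    using disj unfolding disjoint_family_on_def by auto
qed

text \<open>Independence of a family with the single index \<open>()\<close> already includes that
  its members are events.\<close>

lemma frog_algebra_events:
  assumes "X \<subseteq> verts m d" shows "sets (frog_algebra X) \<subseteq> events"
  using indep_frogs[of "{()}" "\<lambda>_. X"] assms by (auto simp: indep_sets_def disjoint_family_on_def)

lemma indep_walk_lifetime:
  assumes u: "u \<in> verts m d"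
  shows "prob ({\<omega> \<in> space M. \<forall>k\<le>i. S u k \<omega> = x k} \<inter> {\<omega> \<in> space M. enat i < \<Xi> u \<omega>}) =
    prob {\<omega> \<in> space M. \<forall>k\<le>i. S u k \<omega> = x k} * p ^ i"
proof -
  let ?A = "case_sum (\<lambda>_. {\<omega> \<in> space M. \<forall>k\<le>i. S u k \<omega> = x k}) (\<lambda>_. {\<omega> \<in> space M. enat i < \<Xi> u \<omega>})"
  have "{\<omega> \<in> space M. \<forall>k\<le>i. S u k \<omega> = x k} = (\<Inter>k\<in>{..i}. {\<omega> \<in> space M. S u k \<omega> \<in> {x k}})"
    by auto
  also have "\<dots> \<in> frog_sets (Inl u)"
  proof -
    have "{\<omega> \<in> space M. S u k \<omega> \<in> {x k}} \<in> sets (vimage_algebra (space M) (\<lambda>\<omega> n. S u n \<omega>) (Pi\<^sub>M UNIV (\<lambda>_. count_space UNIV)))" for k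
      using S_frog_sets[of u k "{x k}"] by (simp add: frog_sets_def)
    then show ?thesis unfolding frog_sets_def sum.case by (intro sets.finite_INT) auto
  qed
  finally have 1: "{\<omega> \<in> space M. \<forall>k\<le>i. S u k \<omega> = x k} \<in> frog_sets (Inl u)" .
  have 2: "{\<omega> \<in> space M. enat i < \<Xi> u \<omega>} \<in> frog_sets (Inr u)"
    using \<Xi>_frog_sets[of u "{enat i<..}"] by simp
  have "prob (\<Inter>j\<in>{Inl u, Inr u}. ?A j) = (\<Prod>j\<in>{Inl u, Inr u}. prob (?A j))"
    by (rule indep_setsD[OF independence[folded frog_sets_def]]) (use u 1 2 in auto)
  then show ?thesis using lifetime_law[OF u, of i] by simp
qed

section \<open>Path law of one frog\<close>

definition path_weight :: "vertex \<Rightarrow> nat \<Rightarrow> (nat \<Rightarrow> vertex) \<Rightarrow> real" where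
  "path_weight u i x = (if x 0 = u then \<Prod>k<i. step_prob m d \<alpha> (x k) (x (Suc k)) else 0)"

lemma path_weight_verts:
  assumes u: "u \<in> verts m d" shows "path_weight u i x \<noteq> 0 \<Longrightarrow> x i \<in> verts m d"
proof (induction i)
  case (Suc i)
  then have *: "x i \<in> verts m d" "step_prob m d \<alpha> (x i) (x (Suc i)) \<noteq> 0"
    by (auto simp: path_weight_def split: if_splits)
  then have "x (Suc i) \<in> nbrs m d (x i)" using step_prob_outside_nbrs[OF m2] by blast
  then show ?case using nbrs_in_verts[OF m2 *(1)] by auto
qed (use u in \<open>auto simp: path_weight_def split: if_splits\<close>)

text \<open>This is the Markov property at time i, stated for cylinder events: after the prefix x 0,
  ..., x i the walk behaves like \<open>hit\<close> from x i, and p ^ i is the chance of being alive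
  at time i. The induction fixes one more coordinate at each step.\<close>

lemma prob_visits:
  assumes u: "u \<in> verts m d"
  shows "prob {\<omega> \<in> space M. (\<forall>k\<le>i. S u k \<omega> = x k) \<and> visits (\<lambda>k. S u k \<omega>) (\<Xi> u \<omega>) i n vs}
    = path_weight u i x * p ^ i * hitn n (x i) vs"
proof (induction "n + length vs" arbitrary: i n vs x rule: less_induct)
  case less
  note [measurable] = walk_measurable[OF u] lifetime_measurable[OF u] pred_visits[OF walk_measurable[OF u] lifetime_measurable[OF u]]
  have P_ev: "{\<omega> \<in> space M. \<forall>k\<le>i. S u k \<omega> = x k} \<in> events" for i x
    by measurable
  have V_ev: "{\<omega> \<in> space M. (\<forall>k\<le>i. S u k \<omega> = x k) \<and> visits (\<lambda>k. S u k \<omega>) (\<Xi> u \<omega>) j n vs} \<in> events" for i j n vs x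
    by measurable
  have W: "prob {\<omega> \<in> space M. \<forall>k\<le>i. S u k \<omega> = x k} = path_weight u i x" for i x
    using walk_law[OF u, of i x] by (simp add: path_weight_def)
  show ?case
  proof (cases vs)
    case Nil
    have "{\<omega> \<in> space M. (\<forall>k\<le>i. S u k \<omega> = x k) \<and> visits (\<lambda>k. S u k \<omega>) (\<Xi> u \<omega>) i n vs} =
      {\<omega> \<in> space M. \<forall>k\<le>i. S u k \<omega> = x k} \<inter> {\<omega> \<in> space M. enat i < \<Xi> u \<omega>}" using Nil by auto
    then show ?thesis using indep_walk_lifetime[OF u, of i x] W Nil by simp
  next
    case (Cons v ws)
    consider "x i = v" | "x i \<noteq> v" "n = 0" | k where "x i \<noteq> v" "n = Suc k" by (cases n) auto
    then show ?thesis
    proof cases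
      case 1
      then have "{\<omega> \<in> space M. (\<forall>k\<le>i. S u k \<omega> = x k) \<and> visits (\<lambda>k. S u k \<omega>) (\<Xi> u \<omega>) i n vs} =
        {\<omega> \<in> space M. (\<forall>k\<le>i. S u k \<omega> = x k) \<and> visits (\<lambda>k. S u k \<omega>) (\<Xi> u \<omega>) i n ws}"
        using Cons by auto
      then show ?thesis using less[of n ws i x] Cons 1 by simp
    next
      case 2
      then have "{\<omega> \<in> space M. (\<forall>k\<le>i. S u k \<omega> = x k) \<and> visits (\<lambda>k. S u k \<omega>) (\<Xi> u \<omega>) i n vs} = {}"
        using Cons by auto
      then show ?thesis unfolding Cons using 2 by (simp only: measure_empty) simp
    next
      case (3 k)
      let ?P = "{\<omega> \<in> space M. \<forall>k\<le>i. S u k \<omega> = x k}"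
      let ?V = "{\<omega> \<in> space M. (\<forall>k\<le>i. S u k \<omega> = x k) \<and> visits (\<lambda>k. S u k \<omega>) (\<Xi> u \<omega>) i n vs}"
      show ?thesis
      proof (cases "path_weight u i x = 0")
        case True
        have "prob ?V \<le> prob ?P" by (intro finite_measure_mono) auto
        then show ?thesis using True W measure_nonneg[of M ?V] by simp
      next
        case False
        have xi: "x i \<in> verts m d" by (rule path_weight_verts[OF u False])
        let ?N = "nbrs m d (x i)"
        let ?y = "\<lambda>y. x(Suc i := y)"
        define PP where "PP y = {\<omega> \<in> space M. \<forall>k\<le>Suc i. S u k \<omega> = ?y y k}" for y
        define VV where "VV y = {\<omega> \<in> space M. (\<forall>k\<le>Suc i. S u k \<omega> = ?y y k) \<and> visits (\<lambda>k. S u k \<omega>) (\<Xi> u \<omega>) (Suc i) k vs}" for y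
        define P where "P = ?P"
        define V where "V = ?V"
        have ev: "P \<in> events" "V \<in> events" "PP y \<in> events" "VV y \<in> events" for y
          using P_ev V_ev by (simp_all only: P_def V_def PP_def VV_def)
        have PP_iff: "\<omega> \<in> PP y \<longleftrightarrow> \<omega> \<in> P \<and> S u (Suc i) \<omega> = y" for \<omega> y
          by (auto simp: PP_def P_def le_Suc_eq)
        have PP_disj: "disjoint_family_on PP ?N"
          using PP_iff by (auto simp: disjoint_family_on_def)
        have V_sub: "V \<subseteq> P" by (auto simp: V_def P_def)
        have VV_eq: "VV y = V \<inter> PP y" for y
          using 3 Cons by (auto simp: V_def VV_def PP_def le_Suc_eq)
        have wt: "path_weight u (Suc i) (?y y) = path_weight u i x * step_prob m d \<alpha> (x i) y" for y
        proof -
          have "(\<Prod>k<i. step_prob m d \<alpha> (?y y k) (?y y (Suc k))) = (\<Prod>k<i. step_prob m d \<alpha> (x k) (x (Suc k)))"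
            by (intro prod.cong) auto
          then show ?thesis by (simp add: path_weight_def)
        qed
        let ?U = "\<Union>y\<in>?N. PP y"
        have U_ev: "?U \<in> events" using ev by (intro sets.finite_UN) simp_all
        \<comment> \<open>The cylinders over the neighbours carry the whole mass of the prefix. A
          jump elsewhere is thus a null event, although single outcomes may contain one.\<close>
        have "prob ?U = (\<Sum>y\<in>?N. prob (PP y))"
          using ev PP_disj by (intro finite_measure_finite_Union) auto
        also have "\<dots> = (\<Sum>y\<in>?N. path_weight u i x * step_prob m d \<alpha> (x i) y)"
          by (simp only: W wt PP_def)
        also have "\<dots> = prob P"
          using sum_step_prob_1[OF m2 d2 xi, of \<alpha>] by (simp add: W P_def sum_distrib_left[symmetric])
        finally have eqN: "prob ?U = prob P" .
        have "?U \<subseteq> P" using PP_iff by blast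
        then have "prob (P - ?U) = 0"
          using finite_measure_Diff[OF ev(1) U_ev] eqN by simp
        moreover have "prob (V - ?U) \<le> prob (P - ?U)"
          using ev U_ev V_sub by (intro finite_measure_mono) auto
        ultimately have null: "prob (V - ?U) = 0"
          using measure_nonneg[of M "V - ?U"] by linarith
        have "prob V = prob (V \<inter> ?U) + prob (V - ?U)"
          using finite_measure_Union[of "V \<inter> ?U" "V - ?U"] ev U_ev by (simp add: Int_Diff_Un Int_Diff_disjoint)
        also have "V \<inter> ?U = (\<Union>y\<in>?N. VV y)" unfolding VV_eq by blast
        also have "prob (\<Union>y\<in>?N. VV y) = (\<Sum>y\<in>?N. prob (VV y))"
          using ev PP_disj by (intro finite_measure_finite_Union) (auto simp: disjoint_family_on_def VV_eq)
        also have "\<dots> = (\<Sum>y\<in>?N. path_weight u i x * step_prob m d \<alpha> (x i) y * p ^ Suc i * hitn k y vs)"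
        proof (rule sum.cong)
          fix y
          show "prob (VV y) = path_weight u i x * step_prob m d \<alpha> (x i) y * p ^ Suc i * hitn k y vs"
            using less[of k vs "Suc i" "?y y"] 3 wt[of y] by (simp add: VV_def)
        qed simp
        also have "\<dots> = path_weight u i x * p ^ i * hitn n (x i) vs"
          using 3 Cons by (simp add: sum_distrib_left mult_ac)
        finally show ?thesis using null by (simp add: V_def)
      qed
    qed
  qed
qed

text \<open>The walk starts at \<open>u\<close> only almost surely; requiring it makes the deterministic wake-up
  argument hold for every outcome.\<close>

definition hits :: "vertex \<Rightarrow> vertex list \<Rightarrow> 'w \<Rightarrow> bool" where
  "hits u vs \<omega> \<longleftrightarrow> (\<exists>n. S u 0 \<omega> = u \<and> visits (\<lambda>k. S u k \<omega>) (\<Xi> u \<omega>) 0 n vs)"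

lemma pred_hits: "u \<in> X \<Longrightarrow> Measurable.pred (frog_algebra X) (hits u vs)"
proof -
  assume u: "u \<in> X"
  note [measurable] = S_measurable_frog_algebra[OF u] \<Xi>_measurable_frog_algebra[OF u]
    pred_visits[OF S_measurable_frog_algebra[OF u] \<Xi>_measurable_frog_algebra[OF u]]
  show ?thesis unfolding hits_def by measurable
qed

lemma prob_hits:
  assumes u: "u \<in> verts m d" shows "prob {\<omega> \<in> space M. hits u vs \<omega>} = H u vs"
proof -
  note [measurable] = walk_measurable[OF u] lifetime_measurable[OF u] pred_visits[OF walk_measurable[OF u] lifetime_measurable[OF u]]
  let ?A = "\<lambda>n. {\<omega> \<in> space M. S u 0 \<omega> = u \<and> visits (\<lambda>k. S u k \<omega>) (\<Xi> u \<omega>) 0 n vs}"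
  have "(\<lambda>n. prob (?A n)) \<longlonglongrightarrow> prob (\<Union>n. ?A n)"
  proof (rule finite_Lim_measure_incseq)
    show "range ?A \<subseteq> events" by (intro image_subsetI) measurable
    show "incseq ?A" using visits_mono by (intro monoI) blast
  qed
  moreover have "prob (?A n) = hitn n u vs" for n
    using prob_visits[OF u, of 0 "\<lambda>_. u" n vs] by (simp add: path_weight_def)
  moreover have "(\<Union>n. ?A n) = {\<omega> \<in> space M. hits u vs \<omega>}" by (auto simp: hits_def)
  ultimately show ?thesis using hit_tendsto[OF u, of vs] LIMSEQ_unique by fastforce
qed

lemma hits_append: "hits u (vs @ ws) \<omega> \<Longrightarrow> hits u vs \<omega>"
  using visits_append unfolding hits_def by blast

end

section \<open>The embedded branching process\<close>

definition below :: "nat \<Rightarrow> nat \<Rightarrow> vertex \<Rightarrow> vertex set" where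
  "below m d u = {x \<in> verts m d. take (length u) x = u}"

definition descendants :: "nat \<Rightarrow> nat \<Rightarrow> nat \<Rightarrow> vertex \<Rightarrow> vertex set" where
  "descendants m d k u = {x \<in> below m d u. length x = length u + k}"

text \<open>Generation k is left out, because the frog at such a descendant belongs to that
  descendant as the next individual. Hence the blocks of different individuals are disjoint.\<close>

definition block :: "nat \<Rightarrow> nat \<Rightarrow> nat \<Rightarrow> vertex \<Rightarrow> vertex set" where
  "block m d k u = {x \<in> below m d u. length x < length u + k}"

lemma below_trans: "v \<in> below m d u \<Longrightarrow> below m d v \<subseteq> below m d u"
proof
  fix x assume v: "v \<in> below m d u" and x: "x \<in> below m d v"
  have "length u \<le> length v" using v by (auto simp: below_def) (metis length_take min.cobounded1)
  then have "take (length u) x = take (length u) (take (length v) x)" by (simp add: min_absorb1)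
  also have "\<dots> = u" using v x by (simp add: below_def)
  finally show "x \<in> below m d u" using x by (simp add: below_def)
qed

lemma descendants_Suc:
  assumes m: "m \<ge> 2" and u: "u \<in> verts m d"
  shows "descendants m d (Suc k) u = (\<Union>v\<in>descendants m d k u. kids m d v)"
proof -
  have "x \<in> descendants m d (Suc k) u \<longleftrightarrow> (\<exists>v\<in>descendants m d k u. x \<in> kids m d v)" for x
  proof
    assume x: "x \<in> descendants m d (Suc k) u"
    then have xV: "x \<in> verts m d" "x \<noteq> []" "length x = Suc (length u + k)" by (auto simp: descendants_def below_def)
    have bV: "butlast x \<in> verts m d" by (rule verts_butlast[OF m xV(1)])
    have "x \<in> kids m d (butlast x)" using in_kids_iff[OF m bV] xV by simp
    moreover have "butlast x \<in> descendants m d k u"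
      using x bV by (auto simp: descendants_def below_def take_butlast)
    ultimately show "\<exists>v\<in>descendants m d k u. x \<in> kids m d v" by blast
  next
    assume "\<exists>v\<in>descendants m d k u. x \<in> kids m d v"
    then obtain v where v: "v \<in> descendants m d k u" "x \<in> kids m d v" by blast
    then have "v \<in> verts m d" by (auto simp: descendants_def below_def)
    then have "x \<in> verts m d" using kids_in_verts[OF m] v by blast
    moreover obtain c where "x = v @ [c]" using v by (auto simp: kids_def)
    ultimately show "x \<in> descendants m d (Suc k) u" using v by (auto simp: descendants_def below_def)
  qed
  then show ?thesis by blast
qed

text \<open>The root is excluded because it has (d + 1)(m - 1) children.\<close>

lemma descendants_finite_card:
  assumes m: "m \<ge> 2" and u: "u \<in> verts m d" "u \<noteq> []"
  shows "finite (descendants m d k u) \<and> card (descendants m d k u) = (d * (m - 1)) ^ k"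
proof (induction k)
  case 0
  have "descendants m d 0 u = {u}" using u by (auto simp: descendants_def below_def)
  then show ?case by simp
next
  case (Suc k)
  have V: "v \<in> verts m d \<and> v \<noteq> []" if "v \<in> descendants m d k u" for v
    using that u by (auto simp: descendants_def below_def)
  have "card (descendants m d (Suc k) u) = (\<Sum>v\<in>descendants m d k u. card (kids m d v))"
    unfolding descendants_Suc[OF m u(1)]
    by (rule card_UN_disjoint) (use Suc in \<open>auto simp: kids_def\<close>)
  also have "\<dots> = (\<Sum>v\<in>descendants m d k u. d * (m - 1))"
    using V card_kids[OF m] by (intro sum.cong) auto
  finally show ?case using Suc unfolding descendants_Suc[OF m u(1)] by simp
qed

context frog_tree
begin

text \<open>\<open>relay u v i j\<close>: on the geodesic from \<open>u\<close> to its descendant \<open>v\<close>, the frog of the \<open>i\<close>-th vertex visits the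
  next ones, up to the \<open>j\<close>-th, in order.\<close>

definition ray :: "vertex \<Rightarrow> vertex \<Rightarrow> nat \<Rightarrow> vertex" where
  "ray u v i = take (length u + i) v"

definition relay :: "vertex \<Rightarrow> vertex \<Rightarrow> nat \<Rightarrow> nat \<Rightarrow> 'w \<Rightarrow> bool" where
  "relay u v i j \<omega> \<longleftrightarrow> hits (ray u v i) (map (ray u v) [Suc i..<Suc j]) \<omega>"

definition chain :: "nat \<Rightarrow> vertex \<Rightarrow> vertex \<Rightarrow> 'w \<Rightarrow> bool" where
  "chain k u v \<omega> \<longleftrightarrow> reach (\<lambda>i j. relay u v i j \<omega>) k"

lemma ray_below:
  assumes "v \<in> descendants m d k u" "i \<le> k"
  shows "ray u v i \<in> below m d u" "length (ray u v i) = length u + i" "ray u v i \<in> verts m d"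
  using assms verts_take[OF m2, of v] by (auto simp: ray_def descendants_def below_def min_def)

lemma ray_Suc_kid:
  assumes v: "v \<in> descendants m d k u" "i < k"
  shows "ray u v (Suc i) \<in> kids m d (ray u v i)"
proof -
  have "butlast (ray u v (Suc i)) = ray u v i" "ray u v (Suc i) \<noteq> []"
    using v ray_below(2)[OF v(1), of "Suc i"] by (auto simp: ray_def butlast_take descendants_def)
  then show ?thesis
    using v in_kids_iff[OF m2 ray_below(3)[of v k u i]] ray_below(3)[of v k u "Suc i"] by simp
qed

text \<open>The shorter list of vertices is a prefix of the longer one. With the intermediate
  vertices recorded, it need not be shown that a walk going down the ray must pass through
  them.\<close>

lemma relay_first: "i < j \<Longrightarrow> relay u v i j \<omega> \<Longrightarrow> relay u v i (Suc i) \<omega>"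
proof -
  assume "i < j" "relay u v i j \<omega>"
  moreover from \<open>i < j\<close> have "[Suc i..<Suc j] = [Suc i..<Suc (Suc i)] @ [Suc (Suc i)..<Suc j]"
    by (simp add: upt_conv_Cons)
  ultimately show ?thesis
    unfolding relay_def by (simp only: map_append hits_append)
qed

lemma pred_relay:
  assumes "v \<in> descendants m d k u" "i < k"
  shows "Measurable.pred (frog_algebra {ray u v i}) (relay u v i j)"
  unfolding relay_def by (rule pred_hits) simp

text \<open>Reaching \<open>ray u v k\<close> = v involves only the frogs at positions below k, and
  these lie in the block of u.\<close>

lemma pred_chain:
  assumes v: "v \<in> descendants m d k u"
  shows "Measurable.pred (frog_algebra (block m d k u)) (chain k u v)"
proof -
  have [measurable]: "Measurable.pred (frog_algebra (block m d k u)) (relay u v i j)" if "i < k" for i j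
    by (rule pred_frog_algebra_mono[OF pred_relay[OF v that]])
       (use ray_below[OF v, of i] that in \<open>auto simp: block_def\<close>)
  have "Measurable.pred (frog_algebra (block m d k u)) (\<lambda>\<omega>. reach (\<lambda>i j. relay u v i j \<omega>) j)" if "j \<le> k" for j
    using that
  proof (induction j rule: less_induct)
    case (less j)
    show ?case
    proof (cases "j = 0")
      case False
      have "Measurable.pred (frog_algebra (block m d k u)) (\<lambda>\<omega>. \<exists>i\<in>{..<j}. reach (\<lambda>i j. relay u v i j \<omega>) i \<and> relay u v i j \<omega> \<and> (\<forall>l\<in>{i<..<j}. \<not> relay u v l (Suc l) \<omega>))"
      proof (rule pred_intros_finite, simp)
        fix i assume i: "i \<in> {..<j}"
        have [measurable]: "Measurable.pred (frog_algebra (block m d k u)) (\<lambda>\<omega>. reach (\<lambda>i j. relay u v i j \<omega>) i)"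
          using less i by simp
        have [measurable]: "Measurable.pred (frog_algebra (block m d k u)) (\<lambda>\<omega>. \<forall>l\<in>{i<..<j}. \<not> relay u v l (Suc l) \<omega>)"
          using less.prems by (intro pred_intros_finite) auto
        have [measurable]: "Measurable.pred (frog_algebra (block m d k u)) (relay u v i j)" using i less.prems by simp
        show "Measurable.pred (frog_algebra (block m d k u)) (\<lambda>\<omega>. reach (\<lambda>i j. relay u v i j \<omega>) i \<and> relay u v i j \<omega> \<and> (\<forall>l\<in>{i<..<j}. \<not> relay u v l (Suc l) \<omega>))"
          by measurable
      qed
      then show ?thesis using False by (simp add: reach_iff)
    qed (simp add: reach_0)
  qed
  then show ?thesis unfolding chain_def by simp
qed

text \<open>\<open>prob_reach_ge\<close> is applied with one sigma-algebra per vertex of the ray.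
  Since the visits are recorded in order, its extension hypothesis is \<open>H_append_ge\<close>:
  going on from position j succeeds with probability at least r.\<close>

lemma prob_chain_ge:
  assumes v: "v \<in> descendants m d k u" and k: "k > 0" and r: "0 \<le> r" "r \<le> 1"
    and level: "\<And>x y. x \<in> verts m d \<Longrightarrow> length x \<ge> length u \<Longrightarrow> y \<in> kids m d x \<Longrightarrow> r \<le> h x y"
  shows "r * (2 * r - r\<^sup>2) ^ (k - 1) \<le> prob {\<omega> \<in> space M. chain k u v \<omega>}"
  unfolding chain_def
proof (rule prob_reach_ge[where G = "\<lambda>i. sets (frog_algebra {ray u v i})"])
  have inj: "ray u v i \<noteq> ray u v j" if "i < k" "j < k" "i \<noteq> j" for i j
    using ray_below(2)[OF v, of i] ray_below(2)[OF v, of j] that by auto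
  show "indep_sets (\<lambda>i. sets (frog_algebra {ray u v i})) {..<k}"
    by (rule indep_frogs) (use ray_below(3)[OF v] inj in \<open>auto simp: disjoint_family_on_def\<close>)
  show "{\<omega> \<in> space M. relay u v i j \<omega>} \<in> sets (frog_algebra {ray u v i})" if "i < j" "j \<le> k" for i j
    using pred_relay[OF v, of i j] that by (auto simp: pred_def)
  show "space M - B \<in> sets (frog_algebra {ray u v i})" if "B \<in> sets (frog_algebra {ray u v i})" for i B
    using sets.compl_sets[OF that] by simp
  show "relay u v i j \<omega> \<Longrightarrow> relay u v i (Suc i) \<omega>" if "i < j" for i j \<omega>
    by (rule relay_first[OF that])
  have P: "prob {\<omega> \<in> space M. relay u v i j \<omega>} = H (ray u v i) (map (ray u v) [Suc i..<Suc j])" if "i < k" for i j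
    unfolding relay_def using prob_hits[OF ray_below(3)[OF v]] that by simp
  have step: "r \<le> h (ray u v i) (ray u v (Suc i))" if "i < k" for i
    using level[OF ray_below(3)[OF v] _ ray_Suc_kid[OF v that]] ray_below(2)[OF v, of i] that by simp
  show "r \<le> prob {\<omega> \<in> space M. relay u v i (Suc i) \<omega>}" if "i < k" for i
    using P[OF that, of "Suc i"] step[OF that] by simp
  show "r * prob {\<omega> \<in> space M. relay u v i j \<omega>} \<le> prob {\<omega> \<in> space M. relay u v i (Suc j) \<omega>}"
    if "i < j" "j < k" for i j
  proof -
    let ?vs = "map (ray u v) [Suc i..<Suc j]"
    have iV: "ray u v i \<in> verts m d" and jV: "ray u v j \<in> verts m d" using ray_below(3)[OF v] that by auto
    have last: "last (ray u v i # ?vs) = ray u v j" using that by simp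
    have "r * H (ray u v i) ?vs \<le> h (ray u v j) (ray u v (Suc j)) * H (ray u v i) ?vs"
      using step[of j] that H_nonneg[OF iV] by (intro mult_right_mono) auto
    also have "\<dots> \<le> H (ray u v i) (?vs @ [ray u v (Suc j)])"
      using H_append_ge[OF iV, of ?vs "[ray u v (Suc j)]"] jV unfolding last by (simp add: mult.commute)
    also have "?vs @ [ray u v (Suc j)] = map (ray u v) [Suc i..<Suc (Suc j)]" using that by simp
    finally show ?thesis using P that by simp
  qed
qed (use k r in auto)

section \<open>Generations of the branching process\<close>

primrec lineage :: "nat \<Rightarrow> nat \<Rightarrow> vertex \<Rightarrow> 'w \<Rightarrow> bool" where
  "lineage k 0 u \<omega> \<longleftrightarrow> True"
| "lineage k (Suc n) u \<omega> \<longleftrightarrow> (\<exists>v\<in>descendants m d k u. chain k u v \<omega> \<and> lineage k n v \<omega>)"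

lemma pred_lineage:
  "u \<in> verts m d \<Longrightarrow> u \<noteq> [] \<Longrightarrow> Measurable.pred (frog_algebra (below m d u)) (lineage k n u)"
proof (induction n arbitrary: u)
  case (Suc n)
  have "Measurable.pred (frog_algebra (below m d u)) (\<lambda>\<omega>. \<exists>v\<in>descendants m d k u. chain k u v \<omega> \<and> lineage k n v \<omega>)"
  proof (rule pred_intros_finite)
    show "finite (descendants m d k u)" using descendants_finite_card[OF m2 Suc.prems] by simp
    fix v assume v: "v \<in> descendants m d k u"
    then have "v \<in> below m d u" "v \<in> verts m d" "v \<noteq> []"
      using Suc.prems by (auto simp: descendants_def below_def)
    then have [measurable]: "Measurable.pred (frog_algebra (below m d u)) (lineage k n v)"
      using pred_frog_algebra_mono[OF Suc.IH below_trans] by blast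
    have [measurable]: "Measurable.pred (frog_algebra (below m d u)) (chain k u v)"
      by (rule pred_frog_algebra_mono[OF pred_chain[OF v]]) (auto simp: block_def)
    show "Measurable.pred (frog_algebra (below m d u)) (\<lambda>\<omega>. chain k u v \<omega> \<and> lineage k n v \<omega>)"
      by measurable
  qed
  then show ?case unfolding lineage.simps(2)[abs_def, symmetric] by simp
next
  case 0
  have "lineage k 0 u = (\<lambda>_. True)" by (simp add: fun_eq_iff)
  then show ?case by simp
qed

text \<open>The bound reproduces itself with the same \<epsilon>. The first generation uses the
  block of u and the other n generations use the disjoint subtrees below the descendants, so
  \<open>prob_branching_ge\<close> applies.\<close>

lemma prob_lineage_ge:
  assumes k: "k > 0" and \<epsilon>: "0 \<le> \<epsilon>" "\<epsilon> \<le> 1"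
    and \<mu>: "((real d * (real m - 1)) ^ k)\<^sup>2 * \<epsilon> \<le> (real d * (real m - 1)) ^ k * c - 1"
    and c: "\<And>u v. u \<in> verts m d \<Longrightarrow> length u \<ge> N \<Longrightarrow> v \<in> descendants m d k u \<Longrightarrow> c \<le> prob {\<omega> \<in> space M. chain k u v \<omega>}"
    and N: "N > 0"
  shows "u \<in> verts m d \<Longrightarrow> length u \<ge> N \<Longrightarrow> \<epsilon> \<le> prob {\<omega> \<in> space M. lineage k n u \<omega>}"
proof (induction n arbitrary: u)
  case 0
  then show ?case using \<epsilon> by (simp add: prob_space)
next
  case (Suc n)
  let ?V = "descendants m d k u"
  have une: "u \<noteq> []" using Suc.prems N by auto
  have fin: "finite ?V" and "card ?V = (d * (m - 1)) ^ k"
    using descendants_finite_card[OF m2 Suc.prems(1) une] by auto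
  then have card: "real (card ?V) = (real d * (real m - 1)) ^ k" using m2 by (simp add: of_nat_diff)
  have V: "v \<in> verts m d" "v \<noteq> []" "length v \<ge> N" "length v = length u + k" "take (length u) v = u" if "v \<in> ?V" for v
    using that Suc.prems une by (auto simp: descendants_def below_def)
  let ?X = "case_option (block m d k u) (below m d)"
  let ?D = "\<lambda>v. {\<omega> \<in> space M. chain k u v \<omega>}" and ?C = "\<lambda>v. {\<omega> \<in> space M. lineage k n v \<omega>}"
  have lin: "?C v \<in> sets (frog_algebra (below m d v))" if "v \<in> ?V" for v
    using pred_lineage[OF V(1,2)[OF that], of k n] by (simp add: pred_def)
  have "\<epsilon> \<le> prob (\<Union>v\<in>?V. ?D v \<inter> ?C v)"
  proof (rule prob_branching_ge)
    have "disjoint_family_on ?X (insert None (Some ` ?V))"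
      unfolding disjoint_family_on_def
    proof (intro ballI impI)
      fix i j assume ij: "i \<in> insert None (Some ` ?V)" "j \<in> insert None (Some ` ?V)" "i \<noteq> j"
      have 1: "block m d k u \<inter> below m d v = {}" if "v \<in> ?V" for v
        using V(4)[OF that] by (auto simp: block_def below_def)
      have 2: "below m d v \<inter> below m d w = {}" if "v \<in> ?V" "w \<in> ?V" "v \<noteq> w" for v w
        using V(4)[OF that(1)] V(4)[OF that(2)] that(3) by (auto simp: below_def)
      show "?X i \<inter> ?X j = {}"
      proof (cases i; cases j)
        fix v w assume "i = Some v" "j = Some w"
        then show ?thesis using ij 2[of v w] by auto
      qed (use ij 1 in \<open>auto simp: Int_commute\<close>)
    qed
    moreover have "?X j \<subseteq> verts m d" for j by (auto simp: block_def below_def split: option.splits)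
    ultimately have "indep_sets (\<lambda>j. sets (frog_algebra (?X j))) (insert None (Some ` ?V))"
      by (intro indep_frogs)
    moreover have "(\<lambda>j. sets (frog_algebra (?X j))) =
      case_option (sets (frog_algebra (block m d k u))) (\<lambda>v. sets (frog_algebra (below m d v)))"
      by (auto simp: fun_eq_iff split: option.split)
    ultimately show "indep_sets (case_option (sets (frog_algebra (block m d k u))) (\<lambda>v. sets (frog_algebra (below m d v)))) (insert None (Some ` ?V))"
      by (simp only:)
    show "sigma_algebra (space M) (sets (frog_algebra (block m d k u)))"
      using sets.sigma_algebra_axioms[of "frog_algebra (block m d k u)"] by simp
    show "?D v \<in> sets (frog_algebra (block m d k u))" if "v \<in> ?V" for v
      using pred_chain[OF that] by (simp add: pred_def)
    show "?C v \<in> events \<and> space M - ?C v \<in> sets (frog_algebra (below m d v))" if "v \<in> ?V" for v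
      using lin[OF that] frog_algebra_events[of "below m d v"] sets.compl_sets[OF lin[OF that]]
      by (auto simp: below_def)
    show "\<epsilon> \<le> prob (?C v)" if "v \<in> ?V" for v
      using Suc.IH V[OF that] by simp
    show "real (card ?V) * c \<le> (\<Sum>v\<in>?V. prob (?D v))"
      by (rule sum_ge_card) (use c Suc.prems in auto)
    show "(real (card ?V))\<^sup>2 * \<epsilon> \<le> real (card ?V) * c - 1" using \<mu> card by simp
  qed (use fin \<epsilon> in auto)
  also have "(\<Union>v\<in>?V. ?D v \<inter> ?C v) = {\<omega> \<in> space M. lineage k (Suc n) u \<omega>}" by auto
  finally show ?case .
qed

lemma lineage_antimono: "lineage k (Suc n) u \<omega> \<Longrightarrow> lineage k n u \<omega>"
  by (induction n arbitrary: u) auto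

text \<open>The direct way down suffices: each step to a child has positive weight because \<alpha>
  < 1, and is survived with probability p > 0.\<close>

lemma h_root_pos:
  assumes v: "v \<in> verts m d" shows "h [] v > 0"
proof -
  have "h (take i v) v > 0" if "i \<le> length v" for i
    using that
  proof (induction rule: inc_induct)
    case (step i)
    let ?x = "take i v" and ?y = "take (Suc i) v"
    have x: "?x \<in> verts m d" and y: "?y \<in> verts m d" using verts_take[OF m2 v] by auto
    have yx: "?y \<in> kids m d ?x"
    proof -
      have "butlast ?y = ?x" "?y \<noteq> []" using step.hyps by (auto simp: butlast_take)
      then show ?thesis using in_kids_iff[OF m2 x] y by simp
    qed
    have "length ?x \<noteq> length v" using step.hyps by simp
    then have ne: "?x \<noteq> v" by metis
    have yN: "?y \<in> nbrs m d ?x" using yx by (auto simp: nbrs_def)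
    have "0 < p * (step_prob m d \<alpha> ?x ?y * h ?y v)"
      using p_pos step_prob_child_pos[OF m2 d2 \<alpha>_lt_1 x yx] step.IH by simp
    also have "\<dots> \<le> p * (\<Sum>z\<in>nbrs m d ?x. step_prob m d \<alpha> ?x z * h z v)"
      using yN nbrs_in_verts[OF m2 x] by (intro mult_left_mono member_le_sum p01 mult_nonneg_nonneg K_nonneg H_nonneg) auto
    also have "\<dots> = h ?x v" using H_step[OF x ne] by simp
    finally show ?case .
  qed simp
  from this[of 0] show ?thesis by simp
qed

section \<open>From lineages to survival\<close>

abbreviation (input) "awakes \<omega> \<equiv> awake (verts m d) (rt m d) (\<lambda>u n. S u n \<omega>) (\<lambda>u. \<Xi> u \<omega>)"

lemma awake_hits:
  assumes u: "awakes \<omega> u" and hits: "hits u vs \<omega>" and v: "v \<in> set vs" "v \<in> verts m d"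
  shows "awakes \<omega> v"
proof -
  obtain n where n: "S u 0 \<omega> = u" "visits (\<lambda>k. S u k \<omega>) (\<Xi> u \<omega>) 0 n vs"
    using hits unfolding hits_def by blast
  obtain k where k: "enat k < \<Xi> u \<omega>" "S u k \<omega> = v"
    using visits_visit[OF n(2) v(1)] by blast
  show ?thesis
  \<comment> \<open>A visit at time 0 wakes nobody, but then v = u because \<open>hits\<close>
    includes \<open>S u 0 \<omega> = u\<close>.\<close>
  proof (cases "k = 0")
    case True
    then show ?thesis using n(1) k(2) u by simp
  next
    case False
    then show ?thesis using awake_visit[OF u, of k] k v(2) by simp
  qed
qed

lemma awake_chain:
  assumes v: "v \<in> descendants m d k u" and u: "awakes \<omega> u" and chain: "chain k u v \<omega>"
  shows "awakes \<omega> v"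
proof -
  have "reach (\<lambda>i j. relay u v i j \<omega>) j \<Longrightarrow> j \<le> k \<Longrightarrow> awakes \<omega> (ray u v j)" for j
  proof (induction rule: reach.induct)
    case reach_0
    have "ray u v 0 = u" using v by (simp add: ray_def descendants_def below_def)
    then show ?case using u by simp
  next
    case (reach_step i j)
    have "ray u v j \<in> set (map (ray u v) [Suc i..<Suc j])" using reach_step.hyps by auto
    then show ?case using awake_hits[OF reach_step.IH] reach_step ray_below(3)[OF v, of j]
      unfolding relay_def by auto
  qed
  moreover have "ray u v k = v" using v by (simp add: ray_def descendants_def)
  ultimately show ?thesis using chain unfolding chain_def by fastforce
qed

lemma awake_lineage:
  "lineage k n u \<omega> \<Longrightarrow> awakes \<omega> u \<Longrightarrow> \<exists>v. awakes \<omega> v \<and> length v = length u + n * k"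
proof (induction n arbitrary: u)
  case (Suc n)
  then obtain v where v: "v \<in> descendants m d k u" "chain k u v \<omega>" "lineage k n v \<omega>" by auto
  then obtain w where "awakes \<omega> w" "length w = length v + n * k"
    using Suc.IH awake_chain[OF v(1) Suc.prems(2) v(2)] by blast
  moreover have "length v = length u + k" using v(1) by (simp add: descendants_def)
  ultimately show ?case by (intro exI[of _ w]) simp
qed auto

text \<open>The lineages for different n may be unrelated. They still give awake vertices at
  infinitely many distances from the root, so no single infinite lineage has to be
  extracted.\<close>

lemma survives_if_lineages:
  assumes k: "k > 0" and v: "v \<in> verts m d" and hits: "hits [] [v] \<omega>" and lin: "\<And>n. lineage k n v \<omega>"
  shows "frogs_survive (verts m d) (rt m d) (\<lambda>u n. S u n \<omega>) (\<lambda>u. \<Xi> u \<omega>)"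
proof (rule frogs_survive_if_infinite_awake, rule notI)
  assume fin: "finite {x. awakes \<omega> x}"
  have "awakes \<omega> []" using awake_root[of "verts m d" "rt m d"] by simp
  then have aw: "awakes \<omega> v" using awake_hits[OF _ hits] v by simp
  have "\<exists>w. awakes \<omega> w \<and> length w = length v + n * k" for n by (rule awake_lineage[OF lin aw])
  then have "range (\<lambda>n. length v + n * k) \<subseteq> length ` {x. awakes \<omega> x}" by (auto simp: image_iff) metis
  then have "finite (range (\<lambda>n. length v + n * k))" using fin finite_subset by blast
  moreover have "inj (\<lambda>n. length v + n * k)" using k by (auto simp: inj_on_def)
  ultimately show False using finite_imageD by fastforce
qed

theorem survival_pos: "prob survival > 0"
proof -
  obtain r N where r: "0 < r" "r \<le> 1" "real d * (real m - 1) * (2 * r - r\<^sup>2) > 1" and N: "N > 0"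
    and level: "\<And>u v. u \<in> verts m d \<Longrightarrow> length u \<ge> N \<Longrightarrow> v \<in> kids m d u \<Longrightarrow> r \<le> h u v"
    by (rule ex_level) blast
  define b where "b = real d * (real m - 1)"
  define q where "q = 2 * r - r\<^sup>2"
  have b1: "b \<ge> 1" using mult_mono[of 1 "real d" 1 "real m - 1"] m2 d2 by (simp add: b_def)
  \<comment> \<open>With k = j + 1 the lower bound for the mean offspring number is b^k c = (b q)^j
    b r; the choice of j makes it exceed 2.\<close>
  obtain j where j: "2 / (b * r) < (b * q) ^ j"
    using real_arch_pow[of "b * q" "2 / (b * r)"] r by (auto simp: b_def q_def)
  define k where "k = Suc j"
  define c where "c = r * q ^ (k - 1)"
  have "2 < (b * q) ^ j * (b * r)" using j b1 r by (simp add: pos_divide_less_eq)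
  also have "\<dots> = b ^ k * c" by (simp add: k_def c_def power_mult_distrib)
  finally have bc: "b ^ k * c \<ge> 2" by simp
  \<comment> \<open>There are b^k candidates, so the quadratic term (b^k)^2 \<epsilon> equals 1,
    which is at most the mean minus 1.\<close>
  define \<epsilon> where "\<epsilon> = 1 / (b ^ k)\<^sup>2"
  have bk: "(b ^ k)\<^sup>2 \<ge> 1" using b1 by simp
  have "0 < (b ^ k)\<^sup>2" using bk by linarith
  then have \<epsilon>: "0 < \<epsilon>" "\<epsilon> \<le> 1" using bk unfolding \<epsilon>_def by (simp_all add: divide_le_eq del: power_mult)
  have b\<epsilon>: "(b ^ k)\<^sup>2 * \<epsilon> \<le> b ^ k * c - 1" using bc b1 by (simp add: \<epsilon>_def)
  have k: "k > 0" by (simp add: k_def)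
  have lin: "\<epsilon> \<le> prob {\<omega> \<in> space M. lineage k n u \<omega>}" if "u \<in> verts m d" "length u \<ge> N" for u n
  proof (rule prob_lineage_ge[OF k _ _ _ _ N that])
    show "((real d * (real m - 1)) ^ k)\<^sup>2 * \<epsilon> \<le> (real d * (real m - 1)) ^ k * c - 1"
      using b\<epsilon> by (simp add: b_def)
    fix u v assume "u \<in> verts m d" "length u \<ge> N" "v \<in> descendants m d k u"
    then show "c \<le> prob {\<omega> \<in> space M. chain k u v \<omega>}"
      unfolding c_def q_def using r level k by (intro prob_chain_ge) auto
  qed (use \<epsilon> in auto)
  obtain v where v: "v \<in> verts m d" "length v \<ge> N" "v \<noteq> []" using ex_deep by blast
  let ?L = "\<lambda>n. {\<omega> \<in> space M. lineage k n v \<omega>}"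
  have L: "?L n \<in> sets (frog_algebra (below m d v))" for n
    using pred_lineage[OF v(1,3), of k n] by (simp add: pred_def)
  have bev: "sets (frog_algebra (below m d v)) \<subseteq> events" by (rule frog_algebra_events) (auto simp: below_def)
  \<comment> \<open>The events of having n generations decrease with n, so the bound \<epsilon>,
    uniform in n, passes to their intersection.\<close>
  have "(\<lambda>n. prob (?L n)) \<longlonglongrightarrow> prob (\<Inter>n. ?L n)"
  proof (rule finite_Lim_measure_decseq)
    show "range ?L \<subseteq> events" using L bev by blast
    show "decseq ?L" by (rule decseq_SucI) (use lineage_antimono in blast)
  qed
  then have L_pos: "\<epsilon> \<le> prob (\<Inter>n. ?L n)" by (rule LIMSEQ_le_const) (use lin v in blast)
  let ?R = "{\<omega> \<in> space M. hits [] [v] \<omega>}"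
  \<comment> \<open>The root is not below the nonempty word v, so the visit of the root frog to v is
    independent of all lineages starting at v.\<close>
  let ?X = "\<lambda>b. if b then {[]} else below m d v"
  have "indep_sets (\<lambda>j. sets (frog_algebra (?X j))) {True, False}"
    by (rule indep_frogs) (use v m2 in \<open>auto simp: below_def disjoint_family_on_def\<close>)
  moreover have R_in: "?R \<in> sets (frog_algebra {[]})"
    using pred_hits[of "[]" "{[]}" "[v]"] by (simp add: pred_def)
  moreover have L_in: "(\<Inter>n. ?L n) \<in> sets (frog_algebra (below m d v))"
    using L by (intro sets.countable_INT') auto
  ultimately have "prob (\<Inter>j\<in>{True, False}. if j then ?R else (\<Inter>n. ?L n)) = (\<Prod>j\<in>{True, False}. prob (if j then ?R else (\<Inter>n. ?L n)))"
    by (intro indep_setsD) auto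
  then have "prob (?R \<inter> (\<Inter>n. ?L n)) = prob ?R * prob (\<Inter>n. ?L n)" by (simp add: Int_commute)
  also have "\<dots> > 0" using prob_hits[of "[]" "[v]"] h_root_pos[OF v(1)] m2 L_pos \<epsilon> by simp
  finally have pos: "0 < prob (?R \<inter> (\<Inter>n. ?L n))" .
  have "?R \<inter> (\<Inter>n. ?L n) \<subseteq> survival"
    using survives_if_lineages[OF k v(1)] by (auto simp: survival_def)
  then have "prob (?R \<inter> (\<Inter>n. ?L n)) \<le> prob survival"
    using survival_event[OF m2] by (rule finite_measure_mono)
  with pos show ?thesis by simp
qed

end

theorem theorem3p2:
  fixes m d :: nat and \<alpha> p :: real
    and M :: "'w measure"
    and S :: "vertex \<Rightarrow> nat \<Rightarrow> 'w \<Rightarrow> vertex"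
    and \<Xi> :: "vertex \<Rightarrow> 'w \<Rightarrow> enat"
  assumes "m \<ge> 2" and "d \<ge> 2"
    and "0 \<le> \<alpha>" and "\<alpha> \<le> 1" and "0 \<le> p" and "p \<le> 1"
    and "A_den m d \<alpha> p \<noteq> 0" and "B_den m d \<alpha> p \<noteq> 0"
    and "\<phi>_fun m d (B_fun m d \<alpha> p) > 1"
    and "frog_model M m d \<alpha> p S \<Xi>"
  shows "measure M (frog_model.survival M m d S \<Xi>) > 0"
proof -
  interpret frog_model M m d \<alpha> p S \<Xi> by fact
  interpret tree_walk m d \<alpha> p using assms by unfold_locales
  interpret frog_tree M m d \<alpha> p S \<Xi> ..
  show ?thesis by (rule survival_pos)
qed

end
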